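(* Let $n\ge3$ and $T_0,\ldots,T_n\in\mathcal{T}^2_2$ be such that $K=D(T_0\ast T_1\ast\cdots\ast T_n)$ is a knot. Suppose that for all $t$ in the complement of a finite subset of $\mathbb{C}$ there exist $\varrho_i\in\mathcal{R}_t(T_i)$, $0\le i\le n$, such that $\mathbf{g}_{\varrho_i}=\mathbf{e}$ for $0\le i\le n$ and $\mathrm{tr}_v(\varrho_i)\notin\{2,t^2-2\}$ for $1\le i\le n$. Then $$\dim\mathcal{X}^{\rm irr}(K)\ge\begin{cases} n-1, & \text{if } \varrho_0(T_0^{\rm ne})\varrho_0(T_0^{\rm se})\neq\varrho_0(T_0^{\rm se})\varrho_0(T_0^{\rm ne}),\\ n-2, & \text{if } \varrho_0(T_0^{\rm ne})\varrho_0(T_0^{\rm se})=\varrho_0(T_0^{\rm se})\varrho_0(T_0^{\rm ne}).\end{cases}$$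
   Context: $G=\mathrm{SL}(2,\mathbb{C})$, $\mathbf{e}$ the identity; $G(t)=\{\mathbf{x}\in G\setminus\{\pm\mathbf{e}\}\colon\mathrm{tr}(\mathbf{x})=t\}$; $\mathbf{a}\lrcorner\mathbf{b}=\mathbf{a}\mathbf{b}\mathbf{a}^{-1}$. For a knot $K\subset S^3$, $\pi(K)$ is the fundamental group of its exterior; $\mathcal{X}^{\rm irr}(K)$ is the set of characters $\chi_\rho\colon g\mapsto\mathrm{tr}\rho(g)$ of irreducible homomorphisms $\rho\colon\pi(K)\to G$ (irreducible = image has no common eigenvector), a Zariski open subset of the $\mathrm{SL}(2,\mathbb{C})$-character variety; its dimension is the maximum dimension of its components. $\mathcal{T}^2_2$ is the set of tangle diagrams in a disk with four ends, called northwest, northeast, southwest, southeast; $T^{\rm nw},T^{\rm ne},T^{\rm sw},T^{\rm se}$ denote the arcs at these ends, each directed outward. A representation of a tangle (or link) diagram is an assignment $\rho$ of an element $\rho(\mathsf{a})\in G$ to each directed arc $\mathsf{a}$ such that $\rho(\mathsf{a}^{-1})=\rho(\mathsf{a})^{-1}$ (where $\mathsf{a}^{-1}$ is the arc with reversed direction) and, at each crossing with overarc $\mathsf{a}$ and underarcs $\mathsf{b}$ (incoming) and $\mathsf{c}$ (outgoing), oriented in the standard Wirtinger way, $\rho(\mathsf{c})=\rho(\mathsf{a})\lrcorner\rho(\mathsf{b})$; for a knot this is the same as a homomorphism $\pi(K)\to G$ via the Wirtinger presentation. $\mathcal{R}_t(T)$ is the set of representations of $T$ with $\rho(\mathsf{a})\in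 G(t)$ for every directed arc $\mathsf{a}$. For $\rho$ a representation of $T\in\mathcal{T}^2_2$: $\mathbf{g}_\rho=\rho(T^{\rm nw})\rho(T^{\rm ne})$ and $\mathrm{tr}_v(\rho)=\mathrm{tr}(\rho(T^{\rm sw})\rho(T^{\rm nw}))$. Operations: the vertical composite $T_1\ast T_2$ places $T_1$ above $T_2$ and joins the SW end of $T_1$ to the NW end of $T_2$ and the SE end of $T_1$ to the NE end of $T_2$ (this is associative). The denominator $D(T)$ is the link obtained from $T$ by joining its NW end to its SW end and its NE end to its SE end by arcs outside the disk; the numerator $N(T)$ joins NW to NE and SW to SE. *)

theory Defs
  imports "HOL-Analysis.Analysis"
begin

type_synonym cmat = "complex^2^2"

definition SL2 :: "cmat set" where
  "SL2 = {x. det x = 1}"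

definition minv :: "cmat \<Rightarrow> cmat" where
  "minv x = matrix_inv x"

definition conjm :: "cmat \<Rightarrow> cmat \<Rightarrow> cmat" where
  "conjm a b = a ** b ** minv a"

definition Gt :: "complex \<Rightarrow> cmat set" where
  "Gt t = {x \<in> SL2. x \<noteq> mat 1 \<and> x \<noteq> - mat 1 \<and> trace x = t}"

text \<open>A diagram is read from top to bottom as a word of elementary slices acting on a row
 of points.  Cross i True: crossing of the strands at positions i, i+1 where the strand
 coming from the top-left (position i) passes over; Cross i False: the strand coming from the
 top-right (position i+1) passes over.  Birth i: a local maximum creating two new points at
 positions i, i+1.  Death i: a local minimum joining the points at positions i, i+1.
 Every planar tangle diagram is planar isotopic to such a sliced diagram.\<close>

datatype gen = Cross nat bool | Birth nat | Death nat

fun wf_word :: "gen list \<Rightarrow> nat \<Rightarrow> nat \<Rightarrow> bool" where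
  "wf_word [] m k = (m = k)"
| "wf_word (Cross i b # w) m k = (i + 1 < m \<and> wf_word w m k)"
| "wf_word (Birth i # w) m k = (i \<le> m \<and> wf_word w (m + 2) k)"
| "wf_word (Death i # w) m k = (i + 1 < m \<and> wf_word w (m - 2) k)"

text \<open>Tangle diagrams in T^2_2: two ends at the top (NW = position 0, NE = position 1) and
 two ends at the bottom (SW = position 0, SE = position 1).\<close>
definition tangle22 :: "gen list \<Rightarrow> bool" where
  "tangle22 w \<longleftrightarrow> wf_word w 2 2"

fun shift_gen :: "nat \<Rightarrow> gen \<Rightarrow> gen" where
  "shift_gen k (Cross i b) = Cross (i + k) b"
| "shift_gen k (Birth i) = Birth (i + k)"
| "shift_gen k (Death i) = Death (i + k)"

definition vcomp :: "gen list \<Rightarrow> gen list \<Rightarrow> gen list" where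
  "vcomp T1 T2 = T1 @ T2"

text \<open>T_0 * T_1 * ... * T_n (the empty word is the trivial tangle, the unit of vcomp).\<close>
definition vcomp_all :: "gen list list \<Rightarrow> gen list" where
  "vcomp_all Ts = foldr vcomp Ts []"

text \<open>Denominator closure: NW joined to SW by an arc on the left, NE joined to SE by an arc
 on the right, outside the disk.  Result is a closed diagram (0 points to 0 points).\<close>
definition denom :: "gen list \<Rightarrow> gen list" where
  "denom T = [Birth 0, Birth 2] @ map (shift_gen 1) T @ [Death 0, Death 0]"

fun width_after :: "gen list \<Rightarrow> nat \<Rightarrow> nat \<Rightarrow> nat" where
  "width_after w m 0 = m"
| "width_after w m (Suc j) =
     (case w ! j of Cross i b \<Rightarrow> width_after w m j
                  | Birth i \<Rightarrow> width_after w m j + 2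
                  | Death i \<Rightarrow> width_after w m j - 2)"

definition level_points :: "gen list \<Rightarrow> nat \<Rightarrow> (nat \<times> nat) set" where
  "level_points w m = {(j, k). j \<le> length w \<and> k < width_after w m j}"

text \<open>Two level points are adjacent if they are joined by a piece of strand within one slice.\<close>
definition adj :: "gen list \<Rightarrow> nat \<Rightarrow> nat \<times> nat \<Rightarrow> nat \<times> nat \<Rightarrow> bool" where
  "adj w m p q \<longleftrightarrow> (\<exists>j < length w. let W = width_after w m j in
     (case w ! j of
        Cross i b \<Rightarrow> p = (j, i) \<and> q = (Suc j, i + 1) \<or> p = (j, i + 1) \<and> q = (Suc j, i)
                     \<or> (\<exists>k < W. k \<noteq> i \<and> k \<noteq> i + 1 \<and> p = (j, k) \<and> q = (Suc j, k))
      | Birth i \<Rightarrow> (\<exists>k < i. p = (j, k) \<and> q = (Suc j, k))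
                     \<or> (\<exists>k. i \<le> k \<and> k < W \<and> p = (j, k) \<and> q = (Suc j, k + 2))
                     \<or> p = (Suc j, i) \<and> q = (Suc j, i + 1)
      | Death i \<Rightarrow> (\<exists>k < i. p = (j, k) \<and> q = (Suc j, k))
                     \<or> (\<exists>k. i \<le> k \<and> k + 2 < W \<and> p = (j, k + 2) \<and> q = (Suc j, k))
                     \<or> p = (j, i) \<and> q = (j, i + 1)))"

definition is_knot :: "gen list \<Rightarrow> bool" where
  "is_knot w \<longleftrightarrow> wf_word w 0 0 \<and> level_points w 0 \<noteq> {} \<and>
     (\<forall>p \<in> level_points w 0. \<forall>q \<in> level_points w 0.
        (\<lambda>x y. adj w 0 x y \<or> adj w 0 y x)\<^sup>*\<^sup>* p q)"

text \<open>A representation is recorded as the list of rows of values: the value at level point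
 (j, k) is rho of the arc through that point, directed downward.  Reversing direction
 inverts the value.  Every arc passes through some level point, so this is the same as an
 assignment to all directed arcs.  Wirtinger relation: for the over arc a (directed), the
 under arc on the left of a equals a conjugating the under arc on its right (under arcs
 directed coherently).\<close>

fun step :: "gen \<Rightarrow> cmat list \<Rightarrow> cmat list \<Rightarrow> bool" where
  "step (Cross i True) xs ys \<longleftrightarrow> i + 1 < length xs \<and>
      ys = xs[i := minv (xs ! i) ** (xs ! (i + 1)) ** (xs ! i), i + 1 := xs ! i]"
| "step (Cross i False) xs ys \<longleftrightarrow> i + 1 < length xs \<and>
      ys = xs[i := xs ! (i + 1), i + 1 := conjm (xs ! (i + 1)) (xs ! i)]"
| "step (Birth i) xs ys \<longleftrightarrow> i \<le> length xs \<and>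
      (\<exists>y. ys = take i xs @ [y, minv y] @ drop i xs)"
| "step (Death i) xs ys \<longleftrightarrow> i + 1 < length xs \<and> xs ! (i + 1) = minv (xs ! i) \<and>
      ys = take i xs @ drop (i + 2) xs"

definition is_rep :: "gen list \<Rightarrow> nat \<Rightarrow> cmat list list \<Rightarrow> bool" where
  "is_rep w m sts \<longleftrightarrow> length sts = length w + 1 \<and> length (sts ! 0) = m \<and>
     (\<forall>j < length w. step (w ! j) (sts ! j) (sts ! Suc j)) \<and>
     (\<forall>xs \<in> set sts. \<forall>x \<in> set xs. x \<in> SL2)"

definition Rt :: "complex \<Rightarrow> gen list \<Rightarrow> cmat list list set" where
  "Rt t T = {sts. is_rep T 2 sts \<and> (\<forall>xs \<in> set sts. \<forall>x \<in> set xs. x \<in> Gt t)}"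

text \<open>Values on the outward directed end arcs.\<close>
definition rho_nw :: "cmat list list \<Rightarrow> cmat" where "rho_nw sts = minv (hd sts ! 0)"
definition rho_ne :: "cmat list list \<Rightarrow> cmat" where "rho_ne sts = minv (hd sts ! 1)"
definition rho_sw :: "cmat list list \<Rightarrow> cmat" where "rho_sw sts = last sts ! 0"
definition rho_se :: "cmat list list \<Rightarrow> cmat" where "rho_se sts = last sts ! 1"

definition g_rho :: "cmat list list \<Rightarrow> cmat" where
  "g_rho sts = rho_nw sts ** rho_ne sts"

definition tr_v :: "cmat list list \<Rightarrow> complex" where
  "tr_v sts = trace (rho_sw sts ** rho_nw sts)"

text \<open>Elements of the knot group are represented by words in the Wirtinger generators
 (arcs, given by level points) and their inverses; a character is recorded as its values on
 all such words.\<close>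
type_synonym gword = "((nat \<times> nat) \<times> bool) list"

definition val :: "cmat list list \<Rightarrow> nat \<times> nat \<Rightarrow> cmat" where
  "val sts p = (if fst p < length sts \<and> snd p < length (sts ! fst p)
                then sts ! fst p ! snd p else mat 1)"

fun eval_word :: "cmat list list \<Rightarrow> gword \<Rightarrow> cmat" where
  "eval_word sts [] = mat 1"
| "eval_word sts ((p, b) # u) =
     (if b then val sts p else minv (val sts p)) ** eval_word sts u"

definition irreducible_rep :: "cmat list list \<Rightarrow> bool" where
  "irreducible_rep sts \<longleftrightarrow>
     \<not> (\<exists>v :: complex^2. v \<noteq> 0 \<and> (\<forall>u. \<exists>c. eval_word sts u *v v = c *s v))"

definition character :: "cmat list list \<Rightarrow> gword \<Rightarrow> complex" where
  "character sts = (\<lambda>u. trace (eval_word sts u))"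

definition Xirr :: "gen list \<Rightarrow> (gword \<Rightarrow> complex) set" where
  "Xirr K = {character sts | sts. is_rep K 0 sts \<and> irreducible_rep sts}"

inductive poly_fn :: "(('i \<Rightarrow> complex) \<Rightarrow> complex) \<Rightarrow> bool" where
  pf_const: "poly_fn (\<lambda>x. c)"
| pf_coord: "poly_fn (\<lambda>x. x i)"
| pf_add: "poly_fn f \<Longrightarrow> poly_fn g \<Longrightarrow> poly_fn (\<lambda>x. f x + g x)"
| pf_mult: "poly_fn f \<Longrightarrow> poly_fn g \<Longrightarrow> poly_fn (\<lambda>x. f x * g x)"

definition zclosed_in :: "('i \<Rightarrow> complex) set \<Rightarrow> ('i \<Rightarrow> complex) set \<Rightarrow> bool" where
  "zclosed_in X S \<longleftrightarrow> (\<exists>P. (\<forall>f \<in> P. poly_fn f) \<and> S = X \<inter> {x. \<forall>f \<in> P. f x = 0})"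

definition zirreducible_in :: "('i \<Rightarrow> complex) set \<Rightarrow> ('i \<Rightarrow> complex) set \<Rightarrow> bool" where
  "zirreducible_in X S \<longleftrightarrow> zclosed_in X S \<and> S \<noteq> {} \<and>
     (\<forall>A B. zclosed_in X A \<and> zclosed_in X B \<and> S \<subseteq> A \<union> B \<longrightarrow> S \<subseteq> A \<or> S \<subseteq> B)"

definition dim_ge :: "('i \<Rightarrow> complex) set \<Rightarrow> nat \<Rightarrow> bool" where
  "dim_ge X d \<longleftrightarrow> (\<exists>Z :: nat \<Rightarrow> ('i \<Rightarrow> complex) set.
     (\<forall>i \<le> d. zirreducible_in X (Z i)) \<and> (\<forall>i < d. Z i \<subset> Z (Suc i)))"

end

theory Submission
  imports Defs "HOL-Library.Function_Algebras"
begin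

text \<open>When every \<open>g_rho\<close> is trivial, the ends of \<open>T\<^sub>i\<close> carry pairs \<open>(x\<^sub>i, x\<^sub>i\<inverse>)\<close> above and
  \<open>(x\<^sub>i\<^sub>+\<^sub>1, x\<^sub>i\<^sub>+\<^sub>1\<inverse>)\<close> below, so conjugates of the given representations glue to a representation
  of the knot exactly when the \<open>x\<^sub>i\<close> form a closed polygon of matrices of trace \<open>t\<close> with prescribed
  side lengths \<open>tr (x\<^sub>i\<inverse> x\<^sub>i\<^sub>+\<^sub>1)\<close>. The diagonals \<open>tr (x\<^sub>0\<inverse> x\<^sub>j)\<close> of such a polygon can be chosen one
  after the other, each avoiding finitely many values. Together with \<open>t\<close> they are \<open>n - 1\<close> free
  parameters, or \<open>n - 2\<close> if the side belonging to \<open>T\<^sub>0\<close> is degenerate.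

  The data depend on \<open>t\<close> in an arbitrary way, so the parameters need not form an algebraic family. The
  dimension bound follows from the Noetherian property alone: infinitely many disjoint irreducible
  closed sets of dimension \<open>d\<close>, lying in different fibres of a regular function, are contained in
  finitely many components, so two of them share a component, which has dimension at least \<open>d + 1\<close>.\<close>

section \<open>Noetherian subrings\<close>

text \<open>Rings are subsets of one ambient ring, so adjoining an element does not change the
  type.\<close>

definition subring1 :: "'a::comm_ring_1 set \<Rightarrow> bool" where
  "subring1 S \<longleftrightarrow> 1 \<in> S \<and> (\<forall>a\<in>S. \<forall>b\<in>S. a - b \<in> S \<and> a * b \<in> S)"

lemma subring1D:
  assumes "subring1 S"
  shows "1 \<in> S" "0 \<in> S" "a \<in> S \<Longrightarrow> b \<in> S \<Longrightarrow> a - b \<in> S" "a \<in> S \<Longrightarrow> b \<in> S \<Longrightarrow> a * b \<in> S"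
    "a \<in> S \<Longrightarrow> - a \<in> S" "a \<in> S \<Longrightarrow> b \<in> S \<Longrightarrow> a + b \<in> S"
proof -
  have d: "a - b \<in> S" if "a \<in> S" "b \<in> S" for a b using assms that by (auto simp: subring1_def)
  show "1 \<in> S" using assms by (auto simp: subring1_def)
  then show z: "0 \<in> S" using d[of 1 1] by simp
  show "a \<in> S \<Longrightarrow> b \<in> S \<Longrightarrow> a * b \<in> S" using assms by (auto simp: subring1_def)
  show "a \<in> S \<Longrightarrow> b \<in> S \<Longrightarrow> a - b \<in> S" by (rule d)
  show n: "- a \<in> S" if "a \<in> S" for a using d[OF z that] by simp
  show "a \<in> S \<Longrightarrow> b \<in> S \<Longrightarrow> a + b \<in> S" using d[of a "- b"] n[of b] by simp
qed

inductive_set ideal_span :: "'a::comm_ring_1 set \<Rightarrow> 'a set \<Rightarrow> 'a set" for S B where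
  zero: "0 \<in> ideal_span S B"
| step: "s \<in> S \<Longrightarrow> b \<in> B \<Longrightarrow> y \<in> ideal_span S B \<Longrightarrow> s * b + y \<in> ideal_span S B"

lemma ideal_span_base:
  assumes "subring1 S" "b \<in> B" shows "b \<in> ideal_span S B"
  using ideal_span.step[OF subring1D(1)[OF assms(1)] assms(2) ideal_span.zero] by simp

lemma ideal_span_add:
  assumes "a \<in> ideal_span S B" "b \<in> ideal_span S B" shows "a + b \<in> ideal_span S B"
  using assms(1)
proof induction
  case (step s c y)
  then show ?case using ideal_span.step[OF step(1,2,4)] by (simp add: add.assoc)
qed (use assms(2) in simp)

lemma ideal_span_mult:
  assumes "subring1 S" "r \<in> S" "a \<in> ideal_span S B" shows "r * a \<in> ideal_span S B"
  using assms(3)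
proof induction
  case (step s c y)
  then show ?case
    using ideal_span.step[OF subring1D(4)[OF assms(1,2) step(1)] step(2,4)]
    by (simp add: algebra_simps)
qed (simp add: ideal_span.zero)

lemma ideal_span_diff:
  assumes "subring1 S" "a \<in> ideal_span S B" "b \<in> ideal_span S B"
  shows "a - b \<in> ideal_span S B"
  using ideal_span_add[OF assms(2) ideal_span_mult[OF assms(1) _ assms(3), of "-1"]]
    subring1D[OF assms(1)] by simp

lemma ideal_span_least:
  assumes "subring1 S" "B \<subseteq> ideal_span S C" shows "ideal_span S B \<subseteq> ideal_span S C"
proof
  fix a assume "a \<in> ideal_span S B"
  then show "a \<in> ideal_span S C"
    by induction (use assms in \<open>auto intro: ideal_span.zero ideal_span_add ideal_span_mult\<close>)
qed

lemma ideal_span_mono: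
  assumes "subring1 S" "B \<subseteq> C" shows "ideal_span S B \<subseteq> ideal_span S C"
  by (rule ideal_span_least[OF assms(1)]) (use assms ideal_span_base[OF assms(1)] in blast)

text \<open>The ascending chain condition for a sequence of generators. The same shape reappears in
  \<open>zariski_noetherian\<close>, which makes the transfer direct.\<close>

definition noetherian_subring :: "'a::comm_ring_1 set \<Rightarrow> bool" where
  "noetherian_subring S \<longleftrightarrow>
     subring1 S \<and> (\<forall>f :: nat \<Rightarrow> 'a. range f \<subseteq> S \<longrightarrow> (\<exists>n. f n \<in> ideal_span S (f ` {..<n})))"

text \<open>The values at \<open>x\<close> of polynomials over \<open>S\<close> of degree less than
  \<open>d\<close>. As \<open>x\<close> may be algebraic over \<open>S\<close>, this filtration
  stands in for the degree.\<close>

primrec below :: "'a::comm_ring_1 set \<Rightarrow> 'a \<Rightarrow> nat \<Rightarrow> 'a set" where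
  "below S x 0 = {0}"
| "below S x (Suc d) = {s * x ^ d + y | s y. s \<in> S \<and> y \<in> below S x d}"

definition adjoin :: "'a::comm_ring_1 set \<Rightarrow> 'a \<Rightarrow> 'a set" where
  "adjoin S x = (\<Union>d. below S x d)"

context
  fixes S :: "'a::comm_ring_1 set" and x :: 'a
  assumes S: "subring1 S"
begin

lemma below_zero: "0 \<in> below S x d"
proof (induction d)
  case (Suc d)
  then show ?case using subring1D(2)[OF S] by (auto intro!: exI[of _ "0::'a"])
qed simp

lemma below_diff: "y \<in> below S x d \<Longrightarrow> z \<in> below S x d \<Longrightarrow> y - z \<in> below S x d"
proof (induction d arbitrary: y z)
  case (Suc d)
  then obtain s y' r z' where *: "y = s * x ^ d + y'" "s \<in> S" "y' \<in> below S x d"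
    "z = r * x ^ d + z'" "r \<in> S" "z' \<in> below S x d" by auto
  have "y - z = (s - r) * x ^ d + (y' - z')" by (simp add: * algebra_simps)
  then show ?case using Suc.IH[OF *(3,6)] subring1D(3)[OF S *(2,5)] by auto
qed simp

lemma below_smult: "r \<in> S \<Longrightarrow> y \<in> below S x d \<Longrightarrow> r * y \<in> below S x d"
proof (induction d arbitrary: y)
  case (Suc d)
  then obtain s y' where *: "y = s * x ^ d + y'" "s \<in> S" "y' \<in> below S x d" by auto
  have "r * y = (r * s) * x ^ d + r * y'" by (simp add: * algebra_simps)
  then show ?case using Suc.IH[OF Suc.prems(1) *(3)] subring1D(4)[OF S Suc.prems(1) *(2)] by auto
qed simp

lemma below_Suc: "y \<in> below S x d \<Longrightarrow> y \<in> below S x (Suc d)"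
  unfolding below.simps
  by (rule CollectI, rule exI[of _ 0], rule exI[of _ y]) (simp add: subring1D(2)[OF S])

lemma below_mono: "d \<le> e \<Longrightarrow> below S x d \<subseteq> below S x e"
  by (rule lift_Suc_mono_le) (use below_Suc in auto)

lemma below_add: "y \<in> below S x d \<Longrightarrow> z \<in> below S x d \<Longrightarrow> y + z \<in> below S x d"
  using below_diff[OF _ below_diff[OF below_zero], of y d z] by simp

lemma below_mult_gen: "y \<in> below S x d \<Longrightarrow> x * y \<in> below S x (Suc d)"
proof (induction d arbitrary: y)
  case 0 then show ?case using below_zero[of 1] by simp
next
  case (Suc d)
  then obtain s y' where *: "y = s * x ^ d + y'" "s \<in> S" "y' \<in> below S x d" by auto
  have "x * y = s * x ^ Suc d + x * y'" by (simp add: * algebra_simps)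
  then show ?case using Suc.IH[OF *(3)] *(2) by auto
qed

lemma below_mult_power: "y \<in> below S x d \<Longrightarrow> x ^ k * y \<in> below S x (k + d)"
proof (induction k)
  case (Suc k)
  then show ?case using below_mult_gen[of "x ^ k * y" "k + d"] by (simp add: mult.assoc)
qed simp

lemma adjoin_add: "y \<in> adjoin S x \<Longrightarrow> z \<in> adjoin S x \<Longrightarrow> y + z \<in> adjoin S x"
  unfolding adjoin_def
  by (auto intro!: below_add dest: subsetD[OF below_mono[OF max.cobounded1]] subsetD[OF below_mono[OF max.cobounded2]])

lemma adjoin_base: "s \<in> S \<Longrightarrow> s \<in> adjoin S x"
  unfolding adjoin_def by (auto intro!: exI[of _ 1] exI[of _ s])

lemma adjoin_gen: "x \<in> adjoin S x"
proof -
  have "1 \<in> below S x 1" using subring1D(1)[OF S] by auto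
  then show ?thesis using below_mult_gen[of 1 1] by (auto simp: adjoin_def simp del: below.simps)
qed

lemma adjoin_smult_power:
  assumes "s \<in> S" "z \<in> adjoin S x" shows "s * x ^ k * z \<in> adjoin S x"
proof -
  obtain d where "z \<in> below S x d" using assms(2) by (auto simp: adjoin_def)
  then have "s * (x ^ k * z) \<in> below S x (k + d)" by (intro below_smult below_mult_power assms(1))
  then show ?thesis by (auto simp: adjoin_def mult.assoc)
qed

lemma subring1_adjoin: "subring1 (adjoin S x)"
  unfolding subring1_def
proof (intro conjI ballI)
  show "1 \<in> adjoin S x" by (rule adjoin_base[OF subring1D(1)[OF S]])
next
  fix a b assume a: "a \<in> adjoin S x" and b: "b \<in> adjoin S x"
  have "(- 1) * x ^ 0 * b \<in> adjoin S x"
    by (intro adjoin_smult_power b subring1D(5)[OF S] subring1D(1)[OF S])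
  from adjoin_add[OF a this] show "a - b \<in> adjoin S x" by simp
  have "y * b \<in> adjoin S x" if "y \<in> below S x d" for y d using that
  proof (induction d arbitrary: y)
    case 0 then show ?case using adjoin_base[OF subring1D(2)[OF S]] by simp
  next
    case (Suc d)
    then obtain s y' where *: "y = s * x ^ d + y'" "s \<in> S" "y' \<in> below S x d" by auto
    then show ?case
      using adjoin_add[OF adjoin_smult_power[OF *(2) b] Suc.IH[OF *(3)], of d]
      by (simp add: distrib_right)
  qed
  then show "a * b \<in> adjoin S x" using a by (auto simp: adjoin_def)
qed

end

text \<open>Hilbert's basis theorem. In an ideal that is not finitely generated choose successively
  elements of least degree outside the ideal generated by the previous ones; the leading coefficients
  contradict the Noetherian property of the base ring. The generator \<open>x\<close> need not be transcendental,
  so ``degree'' refers to some representation as a polynomial in \<open>x\<close>.\<close>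

theorem noetherian_adjoin:
  fixes S :: "'a::comm_ring_1 set"
  assumes "noetherian_subring S"
  shows "noetherian_subring (adjoin S x)"
proof -
  define T where "T = adjoin S x"
  have S: "subring1 S" using assms by (simp add: noetherian_subring_def)
  have T: "subring1 T" unfolding T_def by (rule subring1_adjoin[OF S])
  have ST: "S \<subseteq> T" using adjoin_base[OF S] by (auto simp: T_def)
  have xT: "x ^ k \<in> T" for k
    by (induction k) (use adjoin_gen[OF S] subring1D[OF T] in \<open>auto simp: T_def\<close>)
  have "\<exists>n. F n \<in> ideal_span T (F ` {..<n})" if F: "range F \<subseteq> T" for F :: "nat \<Rightarrow> 'a"
  proof (rule ccontr)
    assume "\<not> ?thesis"
    then have no: "F n \<notin> ideal_span T (F ` {..<n})" for n by auto
    define I where "I = ideal_span T (range F)"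
    have IT: "I \<subseteq> T"
    proof
      fix a assume "a \<in> I" then show "a \<in> T" unfolding I_def
        by induction (use F subring1D[OF T] in auto)
    qed
    have fin: "\<exists>n. a \<in> ideal_span T (F ` {..<n})" if "a \<in> I" for a
      using that unfolding I_def
    proof induction
      case zero then show ?case by (auto intro: ideal_span.zero)
    next
      case (step s b y)
      then obtain n m where n: "y \<in> ideal_span T (F ` {..<n})" and m: "b = F m" by auto
      have "y \<in> ideal_span T (F ` {..<max n (Suc m)})"
        by (rule subsetD[OF ideal_span_mono[OF T image_mono] n]) simp
      then have "s * b + y \<in> ideal_span T (F ` {..<max n (Suc m)})"
        by (intro ideal_span.step) (use step m in auto)
      then show ?case by blast
    qed
    have notfg: "\<exists>y\<in>I. y \<notin> ideal_span T B" if "finite B" "B \<subseteq> I" for B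
    proof -
      have "\<exists>n. B \<subseteq> ideal_span T (F ` {..<n})" using that
      proof (induction)
        case (insert b B)
        then obtain n m where n: "B \<subseteq> ideal_span T (F ` {..<n})" and m: "b \<in> ideal_span T (F ` {..<m})"
          using fin[of b] by auto
        have "ideal_span T (F ` {..<n}) \<subseteq> ideal_span T (F ` {..<max n m})"
          "ideal_span T (F ` {..<m}) \<subseteq> ideal_span T (F ` {..<max n m})"
          by (intro ideal_span_mono[OF T] image_mono; simp)+
        then have "insert b B \<subseteq> ideal_span T (F ` {..<max n m})" using n m by auto
        then show ?case by blast
      qed auto
      then obtain n where "B \<subseteq> ideal_span T (F ` {..<n})" by auto
      then have "F n \<notin> ideal_span T B" using no[of n] ideal_span_least[OF T] by blast
      moreover have "F n \<in> I" unfolding I_def by (rule ideal_span_base[OF T]) auto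
      ultimately show ?thesis by blast
    qed
    \<comment> \<open>Minimality of the degree \<open>d\<close> of \<open>r\<close> is a condition
      on all of \<open>below S x d\<close>, so it applies later to any element of lower degree, in
      particular to the one that gives the contradiction.\<close>
    define P where "P g k r \<longleftrightarrow> r \<in> I \<and> r \<notin> ideal_span T (g ` {..<k}) \<and>
      (\<exists>d. r \<in> below S x (Suc d) \<and> (\<forall>y \<in> I \<inter> below S x d. y \<in> ideal_span T (g ` {..<k})))"
      for g :: "nat \<Rightarrow> 'a" and k r
    have "\<exists>g. \<forall>k. P g k (g k)"
    proof (rule dependent_wellorder_choice)
      fix r and f g :: "nat \<Rightarrow> 'a" and k assume "\<And>y. y < k \<Longrightarrow> f y = g y"
      then have "f ` {..<k} = g ` {..<k}" by auto
      then show "P f k r = P g k r" by (simp add: P_def)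
    next
      fix k and g :: "nat \<Rightarrow> 'a" assume "\<And>y. y < k \<Longrightarrow> P g y (g y)"
      then have "g ` {..<k} \<subseteq> I" by (auto simp: P_def)
      then obtain y where y: "y \<in> I" "y \<notin> ideal_span T (g ` {..<k})" using notfg[of "g ` {..<k}"] by auto
      define Q where "Q d \<longleftrightarrow> (\<exists>y \<in> I \<inter> below S x d. y \<notin> ideal_span T (g ` {..<k}))" for d
      obtain d where "y \<in> below S x d" using y(1) IT by (auto simp: T_def adjoin_def)
      then have "\<exists>d. Q d" using y unfolding Q_def by blast
      then have Q: "Q (LEAST d. Q d)" by (rule LeastI_ex)
      have "\<not> Q 0" by (auto simp: Q_def ideal_span.zero)
      then obtain d where d: "(LEAST d. Q d) = Suc d" using Q by (cases "LEAST d. Q d") auto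
      have "\<not> Q d" using d not_less_Least[of d Q] by simp
      then show "\<exists>r. P g k r" using Q[unfolded d] unfolding P_def Q_def by blast
    qed
    then obtain g where g: "\<And>k. P g k (g k)" by auto
    then have "\<exists>d a l. g k = a * x ^ d + l \<and> a \<in> S \<and> l \<in> below S x d \<and>
      (\<forall>y \<in> I \<inter> below S x d. y \<in> ideal_span T (g ` {..<k}))" for k
      unfolding P_def by fastforce
    then obtain d a l where gk: "\<And>k. g k = a k * x ^ d k + l k" "\<And>k. a k \<in> S"
      "\<And>k. l k \<in> below S x (d k)"
      "\<And>k y. y \<in> I \<Longrightarrow> y \<in> below S x (d k) \<Longrightarrow> y \<in> ideal_span T (g ` {..<k})"
      by (metis IntI)
    have gI: "g k \<in> I" "g k \<notin> ideal_span T (g ` {..<k})" for k using g[of k] by (auto simp: P_def)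
    \<comment> \<open>If the degree dropped, \<open>g k\<close> would lie below the minimal degree
      of the earlier stage \<open>i\<close> and so be generated already there.\<close>
    have dmono: "d i \<le> d k" if "i < k" for i k
    proof (rule ccontr)
      assume "\<not> d i \<le> d k"
      then have "g k \<in> below S x (d i)"
        using gk(1-3)[of k] below_mono[OF S, of "Suc (d k)" "d i" x] by auto
      then have "g k \<in> ideal_span T (g ` {..<i})" by (rule gk(4)[OF gI(1)])
      moreover have "ideal_span T (g ` {..<i}) \<subseteq> ideal_span T (g ` {..<k})"
        using that by (intro ideal_span_mono[OF T]) auto
      ultimately show False using gI(2)[of k] by auto
    qed
    obtain n where n: "a n \<in> ideal_span S (a ` {..<n})"
      using assms gk(2) unfolding noetherian_subring_def by blast
    \<comment> \<open>A relation among leading coefficients lifts to the \<open>g i\<close>: by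
      \<open>dmono\<close> each can be multiplied by a power of \<open>x\<close> that raises its
      degree to \<open>d n\<close>. Subtracting the lift from \<open>g n\<close> cancels the leading
      term.\<close>
    have "\<exists>h \<in> ideal_span T (g ` {..<n}). c * x ^ d n - h \<in> below S x (d n)"
      if "c \<in> ideal_span S (a ` {..<n})" for c
      using that
    proof induction
      case zero
      show ?case by (rule bexI[of _ 0]) (auto simp: ideal_span.zero below_zero[OF S])
    next
      case (step s b y)
      then obtain h i where h: "h \<in> ideal_span T (g ` {..<n})" "y * x ^ d n - h \<in> below S x (d n)"
        and i: "i < n" "b = a i" by auto
      define e where "e = d n - d i"
      have e: "d n = e + d i" using dmono[OF i(1)] by (simp add: e_def)
      have "s * x ^ e * g i + h \<in> ideal_span T (g ` {..<n})"
        by (intro ideal_span.step h) (use i step(1) ST xT subring1D(4)[OF T] in auto)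
      moreover have "(s * b + y) * x ^ d n - (s * x ^ e * g i + h)
          = (y * x ^ d n - h) - s * (x ^ e * l i)"
        by (simp add: gk(1)[of i] i(2) e power_add algebra_simps)
      moreover have "s * (x ^ e * l i) \<in> below S x (d n)"
        unfolding e by (intro below_smult[OF S] below_mult_power[OF S] gk(3) step(1))
      ultimately show ?case using below_diff[OF S h(2)] by metis
    qed
    from this[OF n] obtain h where h: "h \<in> ideal_span T (g ` {..<n})"
      "a n * x ^ d n - h \<in> below S x (d n)" by auto
    have "g n - h = (a n * x ^ d n - h) + l n" by (simp add: gk(1)[of n])
    then have "g n - h \<in> below S x (d n)" using below_add[OF S h(2) gk(3)] by (simp only:)
    moreover have "h \<in> I"
      using ideal_span_least[OF T, of "g ` {..<n}" "range F"] h(1) gI(1) unfolding I_def by blast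
    then have "g n - h \<in> I" unfolding I_def by (intro ideal_span_diff[OF T]) (use gI(1) I_def in auto)
    ultimately have "g n - h \<in> ideal_span T (g ` {..<n})" using gk(4) by blast
    from ideal_span_add[OF this h(1)] show False using gI(2)[of n] by simp
  qed
  then show ?thesis using T unfolding noetherian_subring_def T_def by blast
qed

text \<open>The constants form a field, so one of the first two members of a sequence is generated
  by its predecessors: \<open>f 0\<close> if it vanishes, \<open>f 1\<close> otherwise.\<close>

lemma noetherian_constants: "noetherian_subring (range (\<lambda>c (_::'x). c :: complex))"
  unfolding noetherian_subring_def
proof (intro conjI allI impI)
  show C: "subring1 (range (\<lambda>c (_::'x). c :: complex))"
    by (auto simp: subring1_def fun_eq_iff)
  fix f :: "nat \<Rightarrow> 'x \<Rightarrow> complex" assume f: "range f \<subseteq> range (\<lambda>c _. c)"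
  obtain c where c: "f 0 = (\<lambda>_. c)" using f by blast
  obtain d where d: "f 1 = (\<lambda>_. d)" using f by blast
  show "\<exists>n. f n \<in> ideal_span (range (\<lambda>c _. c)) (f ` {..<n})"
  proof (cases "c = 0")
    case True
    then have "f 0 = 0" by (simp add: c zero_fun_def)
    then show ?thesis using ideal_span.zero by metis
  next
    case False
    have "(\<lambda>_. d / c) * f 0 \<in> ideal_span (range (\<lambda>c _. c)) (f ` {..<1})"
      by (intro ideal_span_mult[OF C] ideal_span_base[OF C]) auto
    moreover have "(\<lambda>_. d / c) * f 0 = f 1" unfolding c d using False by (auto simp: fun_eq_iff)
    ultimately show ?thesis by metis
  qed
qed

text \<open>Start from the constants and adjoin one function at a time by the basis theorem.\<close>

lemma noetherian_function_algebra:
  fixes G :: "('x \<Rightarrow> complex) set"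
  assumes "finite G"
  shows "\<exists>A. noetherian_subring A \<and> range (\<lambda>c _. c) \<subseteq> A \<and> G \<subseteq> A"
  using assms
proof induction
  case empty
  then show ?case using noetherian_constants by blast
next
  case (insert g G)
  then obtain A where A: "noetherian_subring A" "range (\<lambda>c _. c) \<subseteq> A" "G \<subseteq> A" by auto
  have "subring1 A" using A by (simp add: noetherian_subring_def)
  then show ?case
    using noetherian_adjoin[OF A(1), of g] A adjoin_base[of A _ g] adjoin_gen[of A g] by blast
qed

section \<open>Noetherian spaces and dimension\<close>

text \<open>The coordinates may be infinite in number (for characters they are all words), so the
  descending chain condition is a property of \<open>X\<close> that has to be proved.\<close>

definition zariski_noetherian :: "('i \<Rightarrow> complex) set \<Rightarrow> bool" where
  "zariski_noetherian X \<longleftrightarrow> (\<forall>f :: nat \<Rightarrow> ('i \<Rightarrow> complex) \<Rightarrow> complex. (\<forall>n. poly_fn (f n)) \<longrightarrow>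
     (\<exists>n. \<forall>x\<in>X. (\<forall>i<n. f i x = 0) \<longrightarrow> f n x = 0))"

lemma zclosed_in_subset: "zclosed_in X S \<Longrightarrow> S \<subseteq> X"
  by (auto simp: zclosed_in_def)

lemma zclosed_in_Int:
  assumes "zclosed_in X A" "zclosed_in X B" shows "zclosed_in X (A \<inter> B)"
proof -
  obtain P Q where "\<forall>f\<in>P. poly_fn f" "A = X \<inter> {x. \<forall>f\<in>P. f x = 0}"
    "\<forall>f\<in>Q. poly_fn f" "B = X \<inter> {x. \<forall>f\<in>Q. f x = 0}"
    using assms by (auto simp: zclosed_in_def)
  then show ?thesis unfolding zclosed_in_def by (intro exI[of _ "P \<union> Q"]) auto
qed

lemma zclosed_in_Un:
  assumes "zclosed_in X A" "zclosed_in X B" shows "zclosed_in X (A \<union> B)"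
proof -
  obtain P Q where *: "\<forall>f\<in>P. poly_fn f" "A = X \<inter> {x. \<forall>f\<in>P. f x = 0}"
    "\<forall>f\<in>Q. poly_fn f" "B = X \<inter> {x. \<forall>f\<in>Q. f x = 0}"
    using assms by (auto simp: zclosed_in_def)
  have "A \<union> B = X \<inter> {x. \<forall>h \<in> {(\<lambda>x. f x * g x) | f g. f \<in> P \<and> g \<in> Q}. h x = 0}"
  proof (intro set_eqI iffI)
    fix x assume x: "x \<in> X \<inter> {x. \<forall>h \<in> {(\<lambda>x. f x * g x) | f g. f \<in> P \<and> g \<in> Q}. h x = 0}"
    show "x \<in> A \<union> B"
    proof (rule ccontr)
      assume "x \<notin> A \<union> B"
      then obtain f g where fg: "f \<in> P" "f x \<noteq> 0" "g \<in> Q" "g x \<noteq> 0" using x * by auto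
      then have "(\<lambda>x. f x * g x) \<in> {(\<lambda>x. f x * g x) | f g. f \<in> P \<and> g \<in> Q}" by blast
      moreover have "\<forall>h \<in> {(\<lambda>x. f x * g x) | f g. f \<in> P \<and> g \<in> Q}. h x = 0" using x by simp
      ultimately have "(\<lambda>x. f x * g x) x = 0" by (rule bspec[rotated])
      then show False using fg by simp
    qed
  qed (use * in auto)
  moreover have "\<forall>h \<in> {(\<lambda>x. f x * g x) | f g. f \<in> P \<and> g \<in> Q}. poly_fn h"
    using * by (auto intro: pf_mult)
  ultimately show ?thesis unfolding zclosed_in_def by blast
qed

lemma zclosed_in_empty: "zclosed_in X {}"
  unfolding zclosed_in_def by (rule exI[of _ "{\<lambda>_. 1}"]) (auto intro: pf_const)

lemma zclosed_in_self: "zclosed_in X X"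
  unfolding zclosed_in_def by (rule exI[of _ "{}"]) auto

lemma zclosed_in_level:
  assumes "poly_fn f" shows "zclosed_in X (X \<inter> {x. f x = u})"
proof -
  have "poly_fn (\<lambda>x. f x + (- u))" by (intro pf_add assms pf_const)
  then show ?thesis unfolding zclosed_in_def by (intro exI[of _ "{\<lambda>x. f x + (- u)}"]) auto
qed

lemma zclosed_in_Union:
  "finite \<A> \<Longrightarrow> (\<And>A. A \<in> \<A> \<Longrightarrow> zclosed_in X A) \<Longrightarrow> zclosed_in X (\<Union>\<A>)"
  by (induction rule: finite_induct) (auto intro: zclosed_in_empty zclosed_in_Un)

text \<open>For a descending chain pick \<open>f i\<close> vanishing on \<open>C (Suc i)\<close> but
  not at some point \<open>x i\<close> of \<open>C i\<close>. At \<open>x n\<close> all earlier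
  functions vanish and \<open>f n\<close> does not.\<close>

lemma zclosed_wf:
  assumes "zariski_noetherian X"
  shows "wf {(A, B). zclosed_in X A \<and> zclosed_in X B \<and> A \<subset> B}"
  unfolding wf_iff_no_infinite_down_chain
proof
  assume "\<exists>C. \<forall>i. (C (Suc i), C i) \<in> {(A, B). zclosed_in X A \<and> zclosed_in X B \<and> A \<subset> B}"
  then obtain C where "\<forall>i. (C (Suc i), C i) \<in> {(A, B). zclosed_in X A \<and> zclosed_in X B \<and> A \<subset> B}" ..
  then have C: "\<And>i. zclosed_in X (C i)" "\<And>i. C (Suc i) \<subset> C i" by simp_all
  have "\<exists>f x. poly_fn f \<and> x \<in> C i \<and> f x \<noteq> 0 \<and> (\<forall>y \<in> C (Suc i). f y = 0)" for i
  proof -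
    obtain P where P: "\<forall>f\<in>P. poly_fn f" "C (Suc i) = X \<inter> {x. \<forall>f\<in>P. f x = 0}"
      using C(1)[of "Suc i"] by (auto simp: zclosed_in_def)
    obtain x where x: "x \<in> C i" "x \<notin> C (Suc i)" using C(2) by blast
    then have "x \<in> X" using zclosed_in_subset[OF C(1)] by blast
    then obtain f where "f \<in> P" "f x \<noteq> 0" using x P by auto
    then show ?thesis using P x by (intro exI[of _ f] exI[of _ x]) auto
  qed
  then obtain f x where fx: "\<And>i. poly_fn (f i)" "\<And>i. x i \<in> C i" "\<And>i. f i (x i) \<noteq> 0"
    "\<And>i y. y \<in> C (Suc i) \<Longrightarrow> f i y = 0" by metis
  have "\<exists>n. \<forall>x\<in>X. (\<forall>i<n. f i x = 0) \<longrightarrow> f n x = 0"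
    using assms[unfolded zariski_noetherian_def, rule_format, of f] fx(1) by simp
  then obtain n where n: "\<And>x. x \<in> X \<Longrightarrow> (\<forall>i<n. f i x = 0) \<Longrightarrow> f n x = 0" by auto
  have "C n \<subseteq> C (Suc i)" if "i < n" for i
    by (rule lift_Suc_antimono_le[of C]) (use that less_imp_le[OF C(2)] in simp_all)
  then have "\<forall>i<n. f i (x n) = 0" using fx(2)[of n] fx(4) by (meson subsetD)
  moreover have "x n \<in> X" using fx(2)[of n] zclosed_in_subset[OF C(1)] by (rule subsetD[rotated])
  ultimately show False using n[of "x n"] fx(3)[of n] by simp
qed

text \<open>Noetherian induction: a closed set that is neither empty nor irreducible splits into two
  strictly smaller closed sets.\<close>

lemma zclosed_decomposition:
  assumes "zariski_noetherian X" "zclosed_in X S"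
  shows "\<exists>\<A>. finite \<A> \<and> (\<forall>A\<in>\<A>. zirreducible_in X A) \<and> S = \<Union>\<A>"
  using assms(2)
proof (induction S rule: wf_induct_rule[OF zclosed_wf[OF assms(1)]])
  case (1 S)
  show ?case
  proof (cases "S = {} \<or> zirreducible_in X S")
    case True
    then show ?thesis by (elim disjE; intro exI[of _ "if S = {} then {} else {S}"]) (auto simp: zirreducible_in_def)
  next
    case False
    then obtain A B where AB: "zclosed_in X A" "zclosed_in X B" "S \<subseteq> A \<union> B" "\<not> S \<subseteq> A" "\<not> S \<subseteq> B"
      using 1(2) by (auto simp: zirreducible_in_def)
    have "\<exists>\<A>. finite \<A> \<and> (\<forall>A\<in>\<A>. zirreducible_in X A) \<and> S \<inter> A = \<Union>\<A>"
      "\<exists>\<A>. finite \<A> \<and> (\<forall>A\<in>\<A>. zirreducible_in X A) \<and> S \<inter> B = \<Union>\<A>"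
      by (rule 1(1); use 1(2) AB zclosed_in_Int in auto)+
    then obtain \<A> \<B> where
      "finite \<A> \<and> (\<forall>A\<in>\<A>. zirreducible_in X A) \<and> S \<inter> A = \<Union>\<A>"
      "finite \<B> \<and> (\<forall>A\<in>\<B>. zirreducible_in X A) \<and> S \<inter> B = \<Union>\<B>" by (elim exE)
    moreover have "S = (S \<inter> A) \<union> (S \<inter> B)" using AB(3) by blast
    ultimately show ?thesis by (intro exI[of _ "\<A> \<union> \<B>"]) auto
  qed
qed

lemma zirreducible_in_Union:
  assumes "zirreducible_in X S" "finite \<A>" "\<And>A. A \<in> \<A> \<Longrightarrow> zclosed_in X A" "S \<subseteq> \<Union>\<A>"
  shows "\<exists>A\<in>\<A>. S \<subseteq> A"
  using assms(2-4)
proof (induction rule: finite_induct)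
  case empty
  then show ?case using assms(1) by (auto simp: zirreducible_in_def)
next
  case (insert A \<A>)
  have "zclosed_in X (\<Union>\<A>)" by (rule zclosed_in_Union) (use insert in auto)
  then have "S \<subseteq> A \<or> S \<subseteq> \<Union>\<A>"
    using assms(1) insert.prems unfolding zirreducible_in_def by (metis Union_insert insertI1)
  then show ?case using insert by auto
qed

text \<open>The fibres may be taken over different infinite sets at each stage, so no algebraic
  dependence between the values of successive functions is required.\<close>

fun thick :: "(nat \<Rightarrow> 'x \<Rightarrow> complex) \<Rightarrow> nat list \<Rightarrow> 'x set \<Rightarrow> bool" where
  "thick \<phi> [] Y \<longleftrightarrow> Y \<noteq> {}"
| "thick \<phi> (j # js) Y \<longleftrightarrow> infinite {u. thick \<phi> js (Y \<inter> {y. \<phi> j y = u})}"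

text \<open>Only values of the parameters are compared, so thickness passes from polygons to
  characters without any regular map between them.\<close>

lemma thick_map:
  assumes "thick \<psi> js Y" "\<And>y. y \<in> Y \<Longrightarrow> \<exists>x\<in>X. \<forall>j \<in> set js. \<phi> j x = \<psi> j y"
  shows "thick \<phi> js X"
  using assms
proof (induction js arbitrary: X Y)
  case (Cons j js)
  have "{u. thick \<psi> js (Y \<inter> {y. \<psi> j y = u})} \<subseteq> {u. thick \<phi> js (X \<inter> {y. \<phi> j y = u})}"
  proof safe
    fix u assume "thick \<psi> js (Y \<inter> {y. \<psi> j y = u})"
    then show "thick \<phi> js (X \<inter> {y. \<phi> j y = u})"
      by (rule Cons.IH) (use Cons.prems(2) in fastforce)
  qed
  then show ?case using Cons.prems(1) infinite_super by auto
qed auto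

lemma thick_mono:
  assumes "thick \<phi> js Y" "Y \<subseteq> X" shows "thick \<phi> js X"
  using thick_map[OF assms(1), of X \<phi>] assms(2) by blast

text \<open>The inclusion of the top member in \<open>Y\<close> lets the induction place the chains
  for different values of \<open>\<phi> j\<close> in disjoint fibres.\<close>

lemma chain_of_thick:
  assumes "zariski_noetherian X" "\<And>j. poly_fn (\<phi> j)" "zclosed_in X Y" "thick \<phi> js Y"
  shows "\<exists>Z. (\<forall>i \<le> length js. zirreducible_in X (Z i)) \<and> (\<forall>i < length js. Z i \<subset> Z (Suc i)) \<and>
    Z (length js) \<subseteq> Y"
  using assms(3,4)
proof (induction js arbitrary: Y)
  case Nil
  obtain \<A> where \<A>: "finite \<A>" "\<forall>A\<in>\<A>. zirreducible_in X A" "Y = \<Union>\<A>"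
    using zclosed_decomposition[OF assms(1) Nil(1)] by blast
  then obtain A where "A \<in> \<A>" using Nil by auto
  then show ?case using \<A> by (intro exI[of _ "\<lambda>_. A"]) auto
next
  case (Cons j js)
  define U where "U = {u. thick \<phi> js (Y \<inter> {y. \<phi> j y = u})}"
  have inf: "infinite U" using Cons.prems(2) by (simp add: U_def)
  let ?m = "length js"
  have "\<exists>Z. (\<forall>i \<le> ?m. zirreducible_in X (Z i)) \<and> (\<forall>i < ?m. Z i \<subset> Z (Suc i)) \<and>
    Z ?m \<subseteq> Y \<inter> {y. \<phi> j y = u}" if "u \<in> U" for u
  proof (rule Cons.IH)
    have "zclosed_in X (Y \<inter> (X \<inter> {y. \<phi> j y = u}))"
      by (intro zclosed_in_Int zclosed_in_level assms(2) Cons.prems(1))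
    moreover have "Y \<inter> (X \<inter> {y. \<phi> j y = u}) = Y \<inter> {y. \<phi> j y = u}"
      using zclosed_in_subset[OF Cons.prems(1)] by auto
    ultimately show "zclosed_in X (Y \<inter> {y. \<phi> j y = u})" by simp
  qed (use that in \<open>simp add: U_def\<close>)
  then obtain Z where Z: "\<And>u i. u \<in> U \<Longrightarrow> i \<le> ?m \<Longrightarrow> zirreducible_in X (Z u i)"
    "\<And>u i. u \<in> U \<Longrightarrow> i < ?m \<Longrightarrow> Z u i \<subset> Z u (Suc i)"
    "\<And>u. u \<in> U \<Longrightarrow> Z u ?m \<subseteq> Y \<inter> {y. \<phi> j y = u}" by metis
  obtain \<A> where \<A>: "finite \<A>" "\<forall>A\<in>\<A>. zirreducible_in X A" "Y = \<Union>\<A>"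
    using zclosed_decomposition[OF assms(1) Cons.prems(1)] by blast
  have "\<exists>A\<in>\<A>. Z u ?m \<subseteq> A" if "u \<in> U" for u
    by (rule zirreducible_in_Union[OF Z(1)]) (use that \<A> Z(3)[of u] in \<open>auto simp: zirreducible_in_def\<close>)
  then obtain C where C: "\<And>u. u \<in> U \<Longrightarrow> C u \<in> \<A>" "\<And>u. u \<in> U \<Longrightarrow> Z u ?m \<subseteq> C u" by metis
  \<comment> \<open>Pigeonhole: infinitely many values \<open>u\<close>, finitely many
    components.\<close>
  have "\<not> inj_on C U"
    using inf \<A>(1) C(1) by (meson finite_imageD finite_subset image_subsetI)
  then obtain u v where uv: "u \<in> U" "v \<in> U" "u \<noteq> v" "C u = C v" by (auto simp: inj_on_def)
  \<comment> \<open>The component also contains the nonempty \<open>Z v ?m\<close> from another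
    fibre, so it is strictly larger than \<open>Z u ?m\<close> and extends that chain by
    one.\<close>
  have "Z v ?m \<noteq> {}" using Z(1)[of v ?m] uv by (auto simp: zirreducible_in_def)
  then have "Z u ?m \<noteq> C u" using Z(3)[of u] Z(3)[of v] C(2)[of v] uv by fastforce
  then have "Z u ?m \<subset> C u" using C(2) uv by blast
  then show ?case
    using Z[OF uv(1)] C(1)[OF uv(1)] \<A>
    by (intro exI[of _ "\<lambda>i. if i \<le> ?m then Z u i else C u"]) (auto simp: less_Suc_eq le_Suc_eq)
qed

corollary dim_ge_of_thick:
  assumes "zariski_noetherian X" "\<And>j. poly_fn (\<phi> j)" "thick \<phi> js X"
  shows "dim_ge X (length js)"
  using chain_of_thick[OF assms(1,2) zclosed_in_self assms(3)] unfolding dim_ge_def by blast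

section \<open>Two by two matrices of determinant one\<close>

text \<open>The adjugate: the inverse at determinant one, but polynomial in the entries.\<close>

definition adj2 :: "cmat \<Rightarrow> cmat" where
  "adj2 x = vector [vector [x$2$2, - x$1$2], vector [- x$2$1, x$1$1]]"

definition scl :: "complex \<Rightarrow> cmat \<Rightarrow> cmat" where
  "scl c x = (\<chi> i j. c * x$i$j)"

definition cols :: "complex^2 \<Rightarrow> complex^2 \<Rightarrow> cmat" where
  "cols u v = vector [vector [u$1, v$1], vector [u$2, v$2]]"

text \<open>The polar form of the determinant. On \<open>SL2\<close> it is \<open>tr (x\<inverse> y)\<close>.\<close>

definition bform :: "cmat \<Rightarrow> cmat \<Rightarrow> complex" where
  "bform x y = x$1$1 * y$2$2 + x$2$2 * y$1$1 - x$1$2 * y$2$1 - x$2$1 * y$1$2"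

lemmas entrywise = vec_eq_iff forall_2 matrix_matrix_mult_def matrix_vector_mult_def sum_2 det_2
  trace_def mat_def adj2_def scl_def cols_def bform_def

lemma adj2_mult: "det x = 1 \<Longrightarrow> adj2 x ** x = mat 1" "det x = 1 \<Longrightarrow> x ** adj2 x = mat 1"
  by (auto simp: entrywise algebra_simps)

lemma minv_mult:
  assumes "det x \<noteq> 0" shows "x ** minv x = mat 1" "minv x ** x = mat 1"
proof -
  have "invertible x" using assms by (simp add: invertible_det_nz)
  then have "x ** minv x = mat 1 \<and> minv x ** x = mat 1"
    unfolding invertible_def minv_def matrix_inv_def by (rule someI_ex)
  then show "x ** minv x = mat 1" "minv x ** x = mat 1" by auto
qed

lemma minv_unique:
  assumes "x ** y = mat 1" "y ** x = mat 1" shows "minv x = (y::cmat)"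
proof -
  have "invertible x" using assms by (auto simp: invertible_def)
  then have "x ** minv x = mat 1" by (simp add: invertible_det_nz minv_mult)
  then have "y ** (x ** minv x) = y" by simp
  then show ?thesis by (simp add: matrix_mul_assoc assms)
qed

lemma minv_SL2: "det x = 1 \<Longrightarrow> minv x = adj2 x"
  by (rule minv_unique) (simp_all add: adj2_mult)

lemma minv_minv: "det x \<noteq> 0 \<Longrightarrow> minv (minv x) = x"
  by (rule minv_unique) (simp_all add: minv_mult)

lemma det_minv: "det x = 1 \<Longrightarrow> det (minv x) = 1"
  by (simp add: minv_SL2) (simp add: entrywise algebra_simps)

lemma trace_minv_mult: "det x = 1 \<Longrightarrow> trace (minv x ** y) = bform x y"
  by (simp add: minv_SL2) (simp add: entrywise algebra_simps)

lemma trace_mult_minv: "det x = 1 \<Longrightarrow> trace (y ** minv x) = bform x y"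
  by (simp add: minv_SL2) (simp add: entrywise algebra_simps)

lemma bform_sym: "bform x y = bform y x"
  and bform_self: "bform x x = 2 * det x"
  and bform_one: "bform (mat 1) x = trace x" "bform x (mat 1) = trace x"
  and bform_add: "bform (x + y) z = bform x z + bform y z" "bform z (x + y) = bform z x + bform z y"
  and bform_diff: "bform (x - y) z = bform x z - bform y z" "bform z (x - y) = bform z x - bform z y"
  and bform_scl: "bform (scl c x) z = c * bform x z" "bform z (scl c x) = c * bform z x"
  and bform_adj2: "bform (adj2 x) y = trace x * trace y - bform x y"
  and trace_adj2: "trace (adj2 x) = trace x"
  and det_adj2: "det (adj2 x) = det x"
  by (simp_all add: entrywise algebra_simps)

lemma bform_nondegenerate:
  assumes "z \<noteq> 0" shows "\<exists>y. bform z y \<noteq> 0"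
proof (rule ccontr)
  assume "\<nexists>y. bform z y \<noteq> 0"
  then have *: "bform z y = 0" for y by auto
  have "z = 0"
    using *[of "vector [vector [1, 0], vector [0, 0]]"] *[of "vector [vector [0, 1], vector [0, 0]]"]
      *[of "vector [vector [0, 0], vector [1, 0]]"] *[of "vector [vector [0, 0], vector [0, 1]]"]
    by (simp add: entrywise)
  then show False using assms by simp
qed

text \<open>At determinant one this is Fricke's trace identity, as the left side is then 2 minus the
  trace of the group commutator.\<close>

lemma det_commutator:
  "det (a ** b - b ** a) = trace a * trace b * bform a b - (bform a b)\<^sup>2 - (trace a)\<^sup>2 * det b
     - (trace b)\<^sup>2 * det a + 4 * det a * det b"
  by (simp add: entrywise power2_eq_square algebra_simps)

text \<open>Moving a matrix along the commutator therefore changes neither its trace nor its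
  pairings with \<open>a\<close> and \<open>b\<close>.\<close>

lemma bform_commutator:
  "bform (mat 1) (a ** b - b ** a) = 0" "bform a (a ** b - b ** a) = 0" "bform b (a ** b - b ** a) = 0"
  by (simp_all add: entrywise algebra_simps)

text \<open>In contrast to \<open>Gt t\<close>, plus or minus the identity is allowed, which leaves
  only polynomial equations to check.\<close>

definition slt :: "complex \<Rightarrow> cmat set" where
  "slt t = {x. det x = 1 \<and> trace x = t}"

text \<open>By \<open>det_commutator\<close>, the condition excludes exactly the pairs in \<open>slt t\<close> with a common eigenvector.\<close>

definition generic_pair :: "complex \<Rightarrow> cmat \<Rightarrow> cmat \<Rightarrow> bool" where
  "generic_pair t a b \<longleftrightarrow> a \<in> slt t \<and> b \<in> slt t \<and> bform a b \<notin> {2, t\<^sup>2 - 2}"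

lemma generic_pair_det:
  assumes "generic_pair t a b" shows "det (a ** b - b ** a) \<noteq> 0"
proof -
  have "det (a ** b - b ** a) = - ((bform a b - 2) * (bform a b - (t\<^sup>2 - 2)))"
    using assms by (simp add: generic_pair_def slt_def det_commutator power2_eq_square algebra_simps)
  then show ?thesis using assms by (simp add: generic_pair_def)
qed

section \<open>Normal forms and conjugacy of pairs\<close>

lemma mult_vec_zero_det:
  fixes v :: cmat assumes "v *v e = 0" "e \<noteq> 0" shows "det v = 0"
proof -
  have "v$1$1 * e$1 + v$1$2 * e$2 = 0" "v$2$1 * e$1 + v$2$2 * e$2 = 0" "e$1 \<noteq> 0 \<or> e$2 \<noteq> 0"
    using assms by (auto simp: entrywise)
  moreover have "det v * e$1 = v$2$2 * (v$1$1 * e$1 + v$1$2 * e$2) - v$1$2 * (v$2$1 * e$1 + v$2$2 * e$2)"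
    "det v * e$2 = v$1$1 * (v$2$1 * e$1 + v$2$2 * e$2) - v$2$1 * (v$1$1 * e$1 + v$1$2 * e$2)"
    by (simp_all add: det_2 algebra_simps)
  ultimately show ?thesis by auto
qed

text \<open>The commutator would annihilate a common eigenvector, but it is nonsingular.\<close>

lemma generic_pair_no_common_eigenvector:
  assumes "generic_pair t a b" "e \<noteq> 0" "a *v e = \<kappa> *s e" "b *v e = \<mu> *s e"
  shows False
proof -
  have "(a ** b - b ** a) *v e = a *v (b *v e) - b *v (a *v e)"
    by (simp add: matrix_vector_mult_diff_rdistrib matrix_vector_mul_assoc)
  also have "\<dots> = \<mu> *s (\<kappa> *s e) - \<kappa> *s (\<mu> *s e)"
    by (simp only: assms(3,4) vector_scalar_commute)
  also have "\<dots> = 0" by (simp add: mult.commute)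
  finally show False using mult_vec_zero_det assms(2) generic_pair_det[OF assms(1)] by blast
qed

text \<open>The quadratic formula gives \<open>\<kappa>\<close>. The eigenvector is read off from
  the first row of \<open>a - \<kappa>\<close>, from the second row if the first vanishes, and is a
  unit vector if \<open>a\<close> is scalar.\<close>

lemma eigenvector_exists:
  fixes a :: cmat shows "\<exists>\<kappa> e. e \<noteq> 0 \<and> a *v e = \<kappa> *s e \<and> \<kappa>\<^sup>2 - trace a * \<kappa> + det a = 0"
proof -
  define r where "r = csqrt ((trace a)\<^sup>2 - 4 * det a)"
  define \<kappa> where "\<kappa> = (trace a + r) / 2"
  have "r\<^sup>2 = (trace a)\<^sup>2 - 4 * det a" by (simp add: r_def)
  moreover have "2 * \<kappa> = trace a + r" by (simp add: \<kappa>_def)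
  ultimately have "4 * (\<kappa>\<^sup>2 - trace a * \<kappa> + det a) = 0" by algebra
  then have l: "\<kappa>\<^sup>2 - trace a * \<kappa> + det a = 0"
    using mult_eq_0_iff[of "4::complex"] by (simp only:) simp
  show ?thesis
  proof (cases "a$1$2 = 0 \<and> a$1$1 = \<kappa>")
    case True
    show ?thesis
    proof (cases "a$2$1 = 0 \<and> a$2$2 = \<kappa>")
      case True2: True
      show ?thesis using True True2 l
        by (intro exI[of _ \<kappa>] exI[of _ "vector [1, 0]"]) (auto simp: entrywise)
    next
      case False
      then show ?thesis using True l
        by (intro exI[of _ \<kappa>] exI[of _ "vector [\<kappa> - a$2$2, a$2$1]"])
          (auto simp: entrywise power2_eq_square algebra_simps)
    qed
  next
    case False
    have "a$2$1 * a$1$2 + a$2$2 * (\<kappa> - a$1$1) = \<kappa> * (\<kappa> - a$1$1)"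
      using l by (simp add: det_2 trace_def sum_2 power2_eq_square algebra_simps)
    then show ?thesis using False l
      by (intro exI[of _ \<kappa>] exI[of _ "vector [a$1$2, \<kappa> - a$1$1]"])
        (auto simp: entrywise algebra_simps)
  qed
qed

text \<open>\<open>P\<close> and \<open>Q\<close> are bases in which the two pairs have the same
  matrices \<open>A\<close>, \<open>B\<close>; the change of basis \<open>Q ** minv P\<close>
  intertwines them.\<close>

lemma intertwiner_of_common_form:
  fixes a b x y P Q :: cmat
  assumes "det P \<noteq> 0" "det Q \<noteq> 0" "a ** P = P ** A" "b ** P = P ** B" "x ** Q = Q ** A" "y ** Q = Q ** B"
  shows "\<exists>g. det g \<noteq> 0 \<and> x ** g = g ** a \<and> y ** g = g ** b"
proof (intro exI conjI)
  have "det (minv P) \<noteq> 0"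
  proof
    assume "det (minv P) = 0"
    then have "det (P ** minv P) = 0" by (simp add: det_mul)
    then show False using minv_mult(1)[OF assms(1)] by simp
  qed
  then show "det (Q ** minv P) \<noteq> 0" using assms(2) by (simp add: det_mul)
  have *: "z ** (Q ** minv P) = Q ** minv P ** c" if "z ** Q = Q ** C" "c ** P = P ** C" for z c C
  proof -
    have "z ** (Q ** minv P) = Q ** (C ** minv P)" by (metis that(1) matrix_mul_assoc)
    also have "C = minv P ** (c ** P)" by (simp add: that(2) matrix_mul_assoc minv_mult assms(1))
    finally show ?thesis by (simp add: matrix_mul_assoc[symmetric] minv_mult assms(1))
  qed
  show "x ** (Q ** minv P) = Q ** minv P ** a" by (rule *[OF assms(5,3)])
  show "y ** (Q ** minv P) = Q ** minv P ** b" by (rule *[OF assms(6,4)])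
qed

text \<open>Cayley-Hamilton, applied to \<open>f\<close>.\<close>

lemma companion_form:
  fixes a :: cmat assumes "det a = 1"
  shows "a ** cols f (a *v f) = cols f (a *v f) ** vector [vector [0, -1], vector [1, trace a]]"
proof -
  have "a$1$1 * a$2$2 = 1 + a$1$2 * a$2$1" using assms by (simp add: det_2 algebra_simps)
  then have "f$i * (a$1$1 * a$2$2) = f$i * (1 + a$1$2 * a$2$1)" for i by simp
  from this[of 1] this[of 2] show ?thesis by (simp add: entrywise algebra_simps)
qed

text \<open>A matrix in \<open>Gt t\<close> has a cyclic vector and is thus conjugate to the
  companion matrix given by its trace. If neither unit vector nor their sum were cyclic, the matrix
  would be scalar.\<close>

lemma conjugate_of_trace_eq:
  assumes "a \<in> Gt t" "x \<in> Gt t"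
  shows "\<exists>g. det g \<noteq> 0 \<and> x ** g = g ** a"
proof -
  have cyc: "\<exists>f. det (cols f (a *v f)) \<noteq> 0" if a: "a \<in> Gt t" for a
  proof (rule ccontr)
    assume "\<nexists>f. det (cols f (a *v f)) \<noteq> 0"
    then have *: "det (cols f (a *v f)) = 0" for f by auto
    have o: "a$2$1 = 0" "a$1$2 = 0"
      using *[of "vector [1, 0]"] *[of "vector [0, 1]"] by (simp_all add: entrywise)
    then have e: "a$2$2 = a$1$1" using *[of "vector [1, 1]"] by (simp add: entrywise)
    have "(a$1$1 - 1) * (a$1$1 + 1) = 0"
      using a o e by (simp add: Gt_def SL2_def det_2 algebra_simps)
    then have "a$1$1 = 1 \<or> a$1$1 = - 1" by (simp add: add_eq_0_iff2)
    then have "a = mat 1 \<or> a = - mat 1" using o e by (auto simp: entrywise)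
    then show False using a by (simp add: Gt_def)
  qed
  obtain f h where "det (cols f (a *v f)) \<noteq> 0" "det (cols h (x *v h)) \<noteq> 0"
    using cyc assms by metis
  moreover have "det a = 1" "det x = 1" "trace a = trace x" using assms by (auto simp: Gt_def SL2_def)
  ultimately show ?thesis
    using intertwiner_of_common_form companion_form[of a f] companion_form[of x h] by metis
qed

text \<open>Polarised Cayley-Hamilton. It gives the action of \<open>a\<close> on
  \<open>b *v e\<close> when \<open>e\<close> is an eigenvector of \<open>a\<close>.\<close>

lemma anticommutator_apply:
  fixes a b :: cmat
  shows "a *v (b *v e) = trace a *s (b *v e) + trace b *s (a *v e) - bform a b *s e - b *v (a *v e)"
  by (simp add: entrywise algebra_simps)

text \<open>In the basis \<open>e, b e\<close>, where \<open>e\<close> is an eigenvector of \<open>a\<close>, both matrices are determined by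
  the eigenvalue and the traces.\<close>

lemma generic_pairs_conjugate:
  assumes "generic_pair t a b" "generic_pair t x y" "bform a b = bform x y"
  shows "\<exists>g. det g \<noteq> 0 \<and> x ** g = g ** a \<and> y ** g = g ** b"
proof -
  have form: "\<exists>P. det P \<noteq> 0 \<and> a ** P = P ** vector [vector [\<kappa>, t * \<kappa> - w], vector [0, t - \<kappa>]] \<and>
      b ** P = P ** vector [vector [0, -1], vector [1, t]]"
    if gp: "generic_pair t a b" and w: "bform a b = w" and e: "e \<noteq> 0" "a *v e = \<kappa> *s e" for a b \<kappa> w e
  proof (intro exI conjI)
    have tr: "trace a = t" "trace b = t" "det b = 1" using gp by (auto simp: generic_pair_def slt_def)
    show "det (cols e (b *v e)) \<noteq> 0"
    proof
      assume d: "det (cols e (b *v e)) = 0"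
      have "\<exists>\<mu>. b *v e = \<mu> *s e"
      proof (cases "e$1 = 0")
        case True
        then have "e$2 \<noteq> 0" using e by (auto simp: entrywise)
        then show ?thesis using d True
          by (intro exI[of _ "(b *v e)$2 / e$2"]) (auto simp: vec_eq_iff forall_2 cols_def det_2)
      next
        case False
        then show ?thesis using d
          by (intro exI[of _ "(b *v e)$1 / e$1"]) (auto simp: vec_eq_iff forall_2 cols_def det_2 field_simps)
      qed
      then show False using generic_pair_no_common_eigenvector[OF gp e] by blast
    qed
    have be: "b *v (\<kappa> *s e) = \<kappa> *s (b *v e)" by (simp add: vector_scalar_commute)
    have "a *v (b *v e) = (t - \<kappa>) *s (b *v e) + (t * \<kappa> - w) *s e"
      using anticommutator_apply[of a b e] unfolding e(2) be tr w
      by (simp add: vec_eq_iff algebra_simps)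
    then show "a ** cols e (b *v e) = cols e (b *v e) ** vector [vector [\<kappa>, t * \<kappa> - w], vector [0, t - \<kappa>]]"
      using e(2) by (simp add: entrywise algebra_simps)
    show "b ** cols e (b *v e) = cols e (b *v e) ** vector [vector [0, -1], vector [1, t]]"
      using companion_form[OF tr(3), of e] tr by simp
  qed
  have tr: "trace a = t" "det a = 1" "trace x = t" "det x = 1"
    using assms by (auto simp: generic_pair_def slt_def)
  obtain \<kappa> e where e: "e \<noteq> 0" "a *v e = \<kappa> *s e" "\<kappa>\<^sup>2 - t * \<kappa> + 1 = 0"
    using eigenvector_exists[of a] tr by auto
  obtain \<mu> f where f: "f \<noteq> 0" "x *v f = \<mu> *s f" "\<mu>\<^sup>2 - t * \<mu> + 1 = 0"
    using eigenvector_exists[of x] tr by auto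
  \<comment> \<open>The eigenvector found for \<open>x\<close> may belong to the other root of the
    characteristic polynomial. One for the same \<open>\<kappa>\<close> is needed to bring both
    pairs to the same form.\<close>
  have "\<exists>f. f \<noteq> 0 \<and> x *v f = \<kappa> *s f"
  proof (cases "\<kappa> = \<mu>")
    case True then show ?thesis using f by auto
  next
    case False
    have "(\<kappa> - \<mu>) * (\<kappa> + \<mu> - t) = 0" using e(3) f(3) by algebra
    then have l: "\<kappa> = t - \<mu>" using False by (simp add: eq_diff_eq)
    let ?A = "vector [vector [\<mu>, t * \<mu> - bform x y], vector [0, t - \<mu>]] :: cmat"
    \<comment> \<open>The eigenvector of the upper triangular \<open>?A\<close> for its second
      diagonal entry, which is \<open>\<kappa>\<close>.\<close>
    let ?c = "vector [t * \<mu> - bform x y, \<kappa> - \<mu>] :: complex^2"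
    obtain P where P: "det P \<noteq> 0" "x ** P = P ** ?A"
      using form[OF assms(2) refl f(1,2)] by auto
    have "P *v ?c \<noteq> 0"
    proof
      assume "P *v ?c = 0"
      moreover have "?c \<noteq> 0" using False by (auto simp: entrywise)
      ultimately show False using mult_vec_zero_det P(1) by blast
    qed
    moreover have "x *v (P *v ?c) = \<kappa> *s (P *v ?c)"
    proof -
      have "?A *v ?c = \<kappa> *s ?c" by (simp add: entrywise l algebra_simps)
      moreover have "x *v (P *v ?c) = P *v (?A *v ?c)" by (simp add: matrix_vector_mul_assoc P(2))
      ultimately show ?thesis by (simp add: vector_scalar_commute)
    qed
    ultimately show ?thesis by blast
  qed
  then obtain f where f: "f \<noteq> 0" "x *v f = \<kappa> *s f" by auto
  from form[OF assms(1) assms(3) e(1,2)] form[OF assms(2) refl f]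
  show ?thesis using intertwiner_of_common_form by blast
qed

text \<open>Prescribing \<open>tr x\<close>, \<open>tr (p\<inverse> x)\<close> and \<open>tr (q\<inverse> x)\<close> leaves an affine line of matrices \<open>x\<close>
  in the direction of the commutator of \<open>p\<close> and \<open>q\<close>, which is anisotropic for a generic pair.\<close>

lemma generic_pair_extend:
  assumes "generic_pair t p q"
  shows "\<exists>x \<in> slt t. bform p x = u \<and> bform q x = s"
proof -
  define w where "w = bform p q"
  define v where "v = p ** q - q ** p"
  \<comment> \<open>\<open>y\<close> is the point of the span of 1, \<open>p\<close>,
    \<open>q\<close> with the prescribed products. In the orthogonal directions p + q - t and p - q
    the linear system is diagonal, with coefficients 2 + w - t^2 and 2 - w, nonzero for a generic
    pair.\<close>
  define \<sigma> where "\<sigma> = (u + s - t\<^sup>2) / (2 + w - t\<^sup>2)"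
  define \<delta> where "\<delta> = (u - s) / (2 - w)"
  define y where "y = scl (t * (1 - \<sigma>) / 2) (mat 1) + scl ((\<sigma> + \<delta>) / 2) p + scl ((\<sigma> - \<delta>) / 2) q"
  have tr: "trace p = t" "trace q = t" "det p = 1" "det q = 1" "2 - w \<noteq> 0" "2 + w - t\<^sup>2 \<noteq> 0"
    using assms by (auto simp: generic_pair_def slt_def w_def algebra_simps)
  have s: "\<sigma> * (2 + w - t\<^sup>2) = u + s - t\<^sup>2" "\<delta> * (2 - w) = u - s"
    using tr by (simp_all add: \<sigma>_def \<delta>_def)
  have qp: "bform q p = w" by (simp add: w_def bform_sym)
  have dv: "det v \<noteq> 0" unfolding v_def by (rule generic_pair_det[OF assms])
  have v0: "bform (mat 1) v = 0" "bform p v = 0" "bform q v = 0"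
    unfolding v_def by (rule bform_commutator)+
  have yv: "bform y v = 0" by (simp add: y_def bform_add bform_scl v0)
  have y: "bform (mat 1) y = t" "bform p y = u" "bform q y = s"
  proof -
    have "trace (mat 1 :: cmat) = 2" by (simp add: entrywise)
    then show "bform (mat 1) y = t"
      by (simp add: y_def bform_add bform_scl bform_one tr field_simps)
    have "2 * bform p y = t\<^sup>2 - t\<^sup>2 * \<sigma> + 2 * (\<sigma> + \<delta>) + (\<sigma> - \<delta>) * w"
      by (simp add: y_def bform_add bform_scl bform_one bform_self tr w_def[symmetric] field_simps power2_eq_square)
    also have "\<dots> = t\<^sup>2 + \<sigma> * (2 + w - t\<^sup>2) + \<delta> * (2 - w)" by (simp add: algebra_simps)
    finally show "bform p y = u" by (simp add: s)
    have "2 * bform q y = t\<^sup>2 - t\<^sup>2 * \<sigma> + 2 * (\<sigma> - \<delta>) + (\<sigma> + \<delta>) * w"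
      by (simp add: y_def bform_add bform_scl bform_one bform_self tr qp field_simps power2_eq_square)
    also have "\<dots> = t\<^sup>2 + \<sigma> * (2 + w - t\<^sup>2) - \<delta> * (2 - w)" by (simp add: algebra_simps)
    finally show "bform q y = s" by (simp add: s)
  qed
  \<comment> \<open>As \<open>y\<close> and \<open>v\<close> are orthogonal, the determinant at
    \<open>y + scl c v\<close> is det y + c^2 det v, and a square root makes it 1.\<close>
  define c where "c = csqrt ((1 - det y) / det v)"
  have c: "c * c * det v = 1 - det y" using dv by (simp add: c_def power2_eq_square[symmetric])
  have "2 * det (y + scl c v) = 2 * (det y + c * c * det v)"
    unfolding bform_self[symmetric] by (simp add: bform_add bform_scl yv bform_sym[of v y] bform_self[of y] bform_self[of v])
  then have "det (y + scl c v) = 1" using c by simp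
  then show ?thesis
    by (intro bexI[of _ "y + scl c v"])
      (simp_all add: slt_def bform_add bform_scl v0 y flip: bform_one(1))
qed

text \<open>For a pair with \<open>tr (p\<inverse> q) = 2\<close> the commutator direction is replaced by the nilpotent matrix
  \<open>q - p\<close>; the determinant is then linear on the line.\<close>

lemma parabolic_pair_extend:
  assumes "p \<in> slt t" "q \<in> slt t" "bform p q = 2" "p \<noteq> q" "t\<^sup>2 \<noteq> 4" "u \<noteq> s"
  shows "\<exists>x \<in> slt t. bform p x = u \<and> bform q x = s"
proof -
  define z where "z = q - p"
  have tr: "trace p = t" "trace q = t" "det p = 1" "det q = 1" using assms by (auto simp: slt_def)
  have z: "bform (mat 1) z = 0" "bform p z = 0" "bform z z = 0"
    using tr assms(3) by (simp_all add: z_def bform_diff bform_one bform_self[of p] bform_self[of q] bform_sym[of q p])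
  have "z \<noteq> 0" using assms(4) by (simp add: z_def)
  then obtain m where m: "bform z m \<noteq> 0" using bform_nondegenerate by blast
  \<comment> \<open>\<open>z\<close> is orthogonal to 1, to \<open>p\<close> and to itself, so the
    product s - u with \<open>z\<close> must come from a multiple of \<open>m\<close>. The primed
    values are what remains for the span of 1 and \<open>p\<close>, whose Gram determinant is 4 -
    t^2.\<close>
  define \<gamma> where "\<gamma> = (s - u) / bform z m"
  define t' where "t' = t - \<gamma> * trace m"
  define u' where "u' = u - \<gamma> * bform p m"
  define y where "y = scl ((2 * t' - t * u') / (4 - t\<^sup>2)) (mat 1) + scl ((2 * u' - t * t') / (4 - t\<^sup>2)) p + scl \<gamma> m"
  have nz: "4 - t\<^sup>2 \<noteq> 0" using assms(5) by auto
  have t1: "trace (mat 1 :: cmat) = 2" by (simp add: entrywise)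
  have "bform (mat 1) y = (2 * (2 * t' - t * u') + t * (2 * u' - t * t')) / (4 - t\<^sup>2) + \<gamma> * trace m"
    by (simp only: y_def bform_add bform_scl bform_one tr t1 add_divide_distrib) (simp add: mult.commute)
  also have "2 * (2 * t' - t * u') + t * (2 * u' - t * t') = t' * (4 - t\<^sup>2)"
    by (simp add: algebra_simps power2_eq_square)
  finally have y1: "bform (mat 1) y = t" using nz by (simp add: t'_def)
  have "bform p y = (t * (2 * t' - t * u') + 2 * (2 * u' - t * t')) / (4 - t\<^sup>2) + \<gamma> * bform p m"
    by (simp only: y_def bform_add bform_scl bform_one bform_self tr add_divide_distrib) (simp add: mult.commute)
  also have "t * (2 * t' - t * u') + 2 * (2 * u' - t * t') = u' * (4 - t\<^sup>2)"
    by (simp add: algebra_simps power2_eq_square)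
  finally have y2: "bform p y = u" using nz by (simp add: u'_def)
  have y3: "bform z y = s - u"
    using m by (simp add: y_def bform_add bform_scl bform_sym[of z "mat 1"] bform_sym[of z p] z \<gamma>_def)
  \<comment> \<open>As \<open>z\<close> is isotropic, the determinant changes along it at the
    constant rate s - u, which is nonzero.\<close>
  define c where "c = (1 - det y) / (s - u)"
  have "2 * det (y + scl c z) = 2 * (det y + c * (s - u))"
    unfolding bform_self[symmetric]
    by (simp add: bform_add bform_scl bform_sym[of y z] y3 z bform_self[of y] algebra_simps)
  then have d: "det (y + scl c z) = 1" using assms(6) by (simp add: c_def)
  have q: "q = p + z" by (simp add: z_def)
  have "bform q (y + scl c z) = s"
    unfolding q by (simp add: bform_add bform_scl y2 y3 z)
  then show ?thesis
    using d by (intro bexI[of _ "y + scl c z"])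
      (simp_all add: slt_def bform_add bform_scl z y1 y2 flip: bform_one(1))
qed

text \<open>If \<open>bform p q\<close> is t^2 - 2, replacing \<open>q\<close> by its inverse turns
  this value into 2 and the target \<open>s\<close> into t^2 - s. The parabolic case then applies as
  long as \<open>u\<close> differs from t^2 - s.\<close>

lemma noncommuting_pair_extend:
  assumes "p \<in> slt t" "q \<in> slt t" "p ** q \<noteq> q ** p" "t\<^sup>2 \<noteq> 4" "u \<noteq> s" "u \<noteq> t\<^sup>2 - s"
  shows "\<exists>x \<in> slt t. bform p x = u \<and> bform q x = s"
proof -
  have tr: "trace p = t" "trace q = t" "det p = 1" "det q = 1" using assms by (auto simp: slt_def)
  consider "generic_pair t p q" | "bform p q = 2" | "bform p q = t\<^sup>2 - 2"
    using assms by (auto simp: generic_pair_def)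
  then show ?thesis
  proof cases
    case 1 then show ?thesis by (rule generic_pair_extend)
  next
    case 2
    then show ?thesis using assms by (intro parabolic_pair_extend) auto
  next
    case 3
    have "p \<noteq> adj2 q" using assms(3) adj2_mult[of q] tr by metis
    moreover have "bform p (adj2 q) = 2"
      by (simp add: bform_sym[of p "adj2 q"] bform_adj2 tr bform_sym[of q p] 3 power2_eq_square)
    ultimately obtain x where x: "x \<in> slt t" "bform p x = u" "bform (adj2 q) x = t\<^sup>2 - s"
      using parabolic_pair_extend[of p t "adj2 q" u "t\<^sup>2 - s"] assms(1,4,6) tr
      by (auto simp: slt_def trace_adj2 det_adj2)
    then have "bform q x = s" by (simp add: bform_adj2 tr slt_def power2_eq_square)
    then show ?thesis using x by blast
  qed
qed

text \<open>The traceless part of \<open>q\<close> is a multiple of that of \<open>p\<close>, and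
  equality of discriminants makes the factor 1 or -1. These are \<open>p\<close> and its
  inverse.\<close>

lemma commuting_pair:
  assumes "p \<in> slt t" "q \<in> slt t" "p ** q = q ** p" "t\<^sup>2 \<noteq> 4"
  shows "q = p \<or> q = adj2 p"
proof -
  have tr: "p$2$2 = t - p$1$1" "q$2$2 = t - q$1$1"   proof -
    have "p$1$1 + p$2$2 = t" "q$1$1 + q$2$2 = t" using assms(1,2) by (simp_all add: slt_def trace_def sum_2)
    then show "p$2$2 = t - p$1$1" "q$2$2 = t - q$1$1" by (simp_all only: eq_diff_eq add.commute)
  qed
  let ?d = "\<lambda>x::cmat. x$1$1 - x$2$2"
  have comm: "p$1$2 * q$2$1 = q$1$2 * p$2$1" "?d p * q$1$2 = ?d q * p$1$2" "?d p * q$2$1 = ?d q * p$2$1"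
  proof -
    have "(p ** q)$i$j = (q ** p)$i$j" for i j using assms(3) by simp
    from this[of 1 1] this[of 1 2] this[of 2 1]
    show "p$1$2 * q$2$1 = q$1$2 * p$2$1" "?d p * q$1$2 = ?d q * p$1$2" "?d p * q$2$1 = ?d q * p$2$1"
      unfolding matrix_matrix_mult_def sum_2 vec_lambda_beta by algebra+
  qed
  have det: "(?d p)\<^sup>2 + 4 * p$1$2 * p$2$1 = t\<^sup>2 - 4" "(?d q)\<^sup>2 + 4 * q$1$2 * q$2$1 = t\<^sup>2 - 4"
  proof -
    have "p$1$1 * p$2$2 - p$1$2 * p$2$1 = 1" "q$1$1 * q$2$2 - q$1$2 * q$2$1 = 1"
      using assms(1,2) by (simp_all add: slt_def det_2)
    then show "(?d p)\<^sup>2 + 4 * p$1$2 * p$2$1 = t\<^sup>2 - 4" "(?d q)\<^sup>2 + 4 * q$1$2 * q$2$1 = t\<^sup>2 - 4"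
      using tr by algebra+
  qed
  \<comment> \<open>The traceless part is encoded by \<open>?d\<close> and the off-diagonal entries.
    \<open>\<Delta>\<close> is the common discriminant and \<open>k\<close>, by \<open>comm\<close>,
    its polarisation at the two matrices, so \<open>k / \<Delta>\<close> is the factor between the
    traceless parts.\<close>
  define \<Delta> where "\<Delta> = t\<^sup>2 - 4"
  define k where "k = ?d p * ?d q + 4 * p$1$2 * q$2$1"
  have q: "\<Delta> * q$1$2 = k * p$1$2" "\<Delta> * q$2$1 = k * p$2$1" "\<Delta> * ?d q = k * ?d p"
  proof -
    show "\<Delta> * q$1$2 = k * p$1$2"
      unfolding \<Delta>_def det(1)[symmetric] k_def using comm by algebra
    show "\<Delta> * q$2$1 = k * p$2$1"
      unfolding \<Delta>_def det(1)[symmetric] k_def using comm by algebra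
    show "\<Delta> * ?d q = k * ?d p"
      unfolding \<Delta>_def det(1)[symmetric] k_def using comm by algebra
  qed
  have nz: "\<Delta> \<noteq> 0" using assms(4) by (simp add: \<Delta>_def)
  have hom: "(r * d)\<^sup>2 + 4 * (r * b) * (r * c) = r\<^sup>2 * (d\<^sup>2 + 4 * b * c)" for r d b c :: complex
    by (simp add: power2_eq_square algebra_simps)
  have "\<Delta>\<^sup>2 * \<Delta> = (\<Delta> * ?d q)\<^sup>2 + 4 * (\<Delta> * q$1$2) * (\<Delta> * q$2$1)"
    unfolding hom using det(2) by (simp add: \<Delta>_def)
  also have "\<dots> = k\<^sup>2 * \<Delta>" unfolding q hom using det(1) by (simp add: \<Delta>_def)
  finally have "k\<^sup>2 = \<Delta>\<^sup>2" using nz by simp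
  then have "k = \<Delta> \<or> k = - \<Delta>" by (simp add: power2_eq_iff)
  then show ?thesis
  proof
    assume "k = \<Delta>"
    then have e: "q$1$2 = p$1$2" "q$2$1 = p$2$1" "?d q = ?d p" using q nz by simp_all
    have "2 * q$1$1 = 2 * p$1$1" using e(3) tr by algebra
    then show ?thesis using e tr by (auto simp: vec_eq_iff forall_2)
  next
    assume "k = - \<Delta>"
    then have "\<Delta> * q$1$2 = \<Delta> * (- p$1$2)" "\<Delta> * q$2$1 = \<Delta> * (- p$2$1)" "\<Delta> * ?d q = \<Delta> * (- ?d p)"
      unfolding q by (simp_all only: mult_minus_left mult_minus_right)
    then have e: "q$1$2 = - p$1$2" "q$2$1 = - p$2$1" "?d q = - ?d p" using nz mult_left_cancel by blast+
    have "2 * q$1$1 = 2 * (t - p$1$1)" using e(3) tr by algebra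
    then have "q$1$1 = t - p$1$1" by (simp only: mult_cancel_left) simp
    then show ?thesis using e tr by (auto simp: vec_eq_iff forall_2 adj2_def)
  qed
qed

section \<open>Representations of sliced diagrams\<close>

lemma split_two:
  assumes "i + 1 < length xs"
  obtains us a b vs where "xs = us @ a # b # vs" "length us = i"
proof
  show "xs = take i xs @ xs ! i # xs ! (i + 1) # drop (i + 2) xs"
    using assms by (simp add: Cons_nth_drop_Suc)
  show "length (take i xs) = i" using assms by simp
qed

lemma step_Cross:
  assumes "length us = i"
  shows "step (Cross i True) (us @ a # b # vs) ys \<longleftrightarrow> ys = us @ (minv a ** b ** a) # a # vs"
    and "step (Cross i False) (us @ a # b # vs) ys \<longleftrightarrow> ys = us @ b # conjm b a # vs"
  using assms by (auto simp: nth_append list_update_append)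

lemma step_Death:
  assumes "length us = i"
  shows "step (Death i) (us @ a # b # vs) ys \<longleftrightarrow> b = minv a \<and> ys = us @ vs"
  using assms by (auto simp: nth_append)

lemma step_Birth:
  assumes "length us = i"
  shows "step (Birth i) (us @ vs) ys \<longleftrightarrow> (\<exists>y. ys = us @ y # minv y # vs)"
  using assms by auto

declare step.simps [simp del]

text \<open>Replaces indexed updates by rows split at the slice, a form compatible with entrywise
  maps and with extra strands on either side.\<close>

lemma step_cases [consumes 1, case_names over_left over_right birth death]:
  assumes "step g xs ys"
  obtains i us a b vs where "g = Cross i True" "length us = i" "xs = us @ a # b # vs"
      "ys = us @ (minv a ** b ** a) # a # vs"
    | i us a b vs where "g = Cross i False" "length us = i" "xs = us @ a # b # vs"
      "ys = us @ b # conjm b a # vs"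
    | i us y vs where "g = Birth i" "length us = i" "xs = us @ vs" "ys = us @ y # minv y # vs"
    | i us a vs where "g = Death i" "length us = i" "xs = us @ a # minv a # vs" "ys = us @ vs"
proof (cases g)
  case (Cross i b)
  have "i + 1 < length xs" using assms by (cases b) (auto simp: Cross step.simps)
  then obtain us x y vs where xs: "xs = us @ x # y # vs" "length us = i" by (rule split_two)
  show ?thesis
    using assms that(1)[of i us x y vs] that(2)[of i us x y vs] xs step_Cross[OF xs(2)]
    by (cases b) (auto simp: Cross)
next
  case (Birth i)
  then have "xs = take i xs @ drop i xs" "length (take i xs) = i" using assms by (auto simp: step.simps)
  then show ?thesis using assms that(3)[of i "take i xs" "drop i xs"] Birth by (auto simp: step.simps)
next
  case (Death i)
  then have "i + 1 < length xs" using assms by (auto simp: step.simps)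
  then obtain us x y vs where xs: "xs = us @ x # y # vs" "length us = i" by (rule split_two)
  show ?thesis using assms that(4)[of i us x vs] xs step_Death[OF xs(2)] by (auto simp: Death)
qed

lemma is_rep_Nil: "is_rep [] m sts \<longleftrightarrow> (\<exists>xs. sts = [xs] \<and> length xs = m \<and> set xs \<subseteq> SL2)"
  by (cases sts) (auto simp: is_rep_def)

lemma is_rep_Cons:
  "is_rep (g # w) m sts \<longleftrightarrow> (\<exists>xs sts'. sts = xs # sts' \<and> length xs = m \<and> set xs \<subseteq> SL2 \<and>
     step g xs (hd sts') \<and> is_rep w (length (hd sts')) sts')"
proof (cases sts)
  case (Cons xs sts')
  have "sts' ! 0 = hd sts'" if "length sts' = Suc k" for k using that by (cases sts') auto
  then show ?thesis
    by (auto simp: Cons is_rep_def All_less_Suc2)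
qed (auto simp: is_rep_def)

lemma is_rep_length: "is_rep w m sts \<Longrightarrow> length sts = length w + 1"
  by (simp add: is_rep_def)

lemma is_rep_SL2: "is_rep w m sts \<Longrightarrow> xs \<in> set sts \<Longrightarrow> set xs \<subseteq> SL2"
  by (auto simp: is_rep_def)

lemma is_rep_append:
  assumes "is_rep w1 m s1" "is_rep w2 k s2" "last s1 = hd s2"
  shows "is_rep (w1 @ w2) m (s1 @ tl s2)"
  using assms(1,3)
proof (induction w1 arbitrary: m s1)
  case Nil
  then obtain xs where "s1 = [xs]" "length xs = m" by (auto simp: is_rep_Nil)
  moreover have "s2 \<noteq> []" using is_rep_length[OF assms(2)] by auto
  moreover from this have "length (hd s2) = k" using assms(2) by (simp add: is_rep_def hd_conv_nth)
  ultimately show ?case using Nil(2) assms(2) by (cases s2) auto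
next
  case (Cons g w1)
  then obtain xs s1' where s: "s1 = xs # s1'" "length xs = m" "set xs \<subseteq> SL2" "step g xs (hd s1')"
    "is_rep w1 (length (hd s1')) s1'" by (auto simp: is_rep_Cons)
  have "s1' \<noteq> []" using is_rep_length[OF s(5)] by auto
  then show ?case using s Cons.IH[OF s(5)] Cons.prems(2) by (auto simp: is_rep_Cons)
qed

lemma is_rep_length_last:
  "is_rep w m sts \<Longrightarrow> wf_word w m k \<Longrightarrow> length (last sts) = k"
proof (induction w arbitrary: m sts)
  case Nil then show ?case by (auto simp: is_rep_Nil)
next
  case (Cons g w)
  then obtain xs s where s: "sts = xs # s" "length xs = m" "step g xs (hd s)"
    "is_rep w (length (hd s)) s" by (auto simp: is_rep_Cons)
  have "s \<noteq> []" using is_rep_length[OF s(4)] by auto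
  moreover have "wf_word w (length (hd s)) k"
    using s(3) Cons.prems(2) s(2) by (cases rule: step_cases) auto
  ultimately show ?case using Cons.IH[OF s(4)] s(1) by simp
qed

text \<open>Confines the level points that carry a value to a finite box depending only on the
  diagram.\<close>

lemma is_rep_length_bound:
  "is_rep w m sts \<Longrightarrow> xs \<in> set sts \<Longrightarrow> length xs \<le> m + 2 * length w"
proof (induction w arbitrary: m sts)
  case Nil then show ?case by (auto simp: is_rep_Nil)
next
  case (Cons g w)
  then obtain ys s where s: "sts = ys # s" "length ys = m" "step g ys (hd s)"
    "is_rep w (length (hd s)) s" by (auto simp: is_rep_Cons)
  have "length (hd s) \<le> m + 2" using s(3) s(2) by (cases rule: step_cases) auto
  then show ?case using Cons.IH[OF s(4)] Cons.prems(2) s(1,2) by fastforce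
qed

text \<open>The product of a row, read from right to left, is the holonomy of a horizontal line and does
  not change from slice to slice.\<close>

primrec row_prod :: "cmat list \<Rightarrow> cmat" where
  "row_prod [] = mat 1"
| "row_prod (x # xs) = row_prod xs ** x"

lemma row_prod_append: "row_prod (xs @ ys) = row_prod ys ** row_prod xs"
  by (induction xs) (simp_all add: matrix_mul_assoc)

lemma SL2_cancel:
  assumes "x \<in> SL2" shows "minv x ** x = mat 1" "x ** minv x = mat 1"
    "y ** minv x ** x = y" "y ** x ** minv x = y"
proof -
  show *: "minv x ** x = mat 1" "x ** minv x = mat 1" using assms by (simp_all add: SL2_def minv_mult)
  show "y ** minv x ** x = y" "y ** x ** minv x = y" by (simp_all add: matrix_mul_assoc[symmetric] *)
qed

lemma row_prod_step:
  assumes "step g xs ys" "set xs \<subseteq> SL2" "set ys \<subseteq> SL2" shows "row_prod ys = row_prod xs"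
  using assms
  by (cases rule: step_cases)
    (auto simp: row_prod_append matrix_mul_assoc SL2_cancel conjm_def)

lemma row_prod_rep: "is_rep w m sts \<Longrightarrow> row_prod (last sts) = row_prod (hd sts)"
proof (induction w arbitrary: m sts)
  case Nil then show ?case by (auto simp: is_rep_Nil)
next
  case (Cons g w)
  then obtain xs s where s: "sts = xs # s" "set xs \<subseteq> SL2" "step g xs (hd s)"
    "is_rep w (length (hd s)) s" by (auto simp: is_rep_Cons)
  have "s \<noteq> []" using is_rep_length[OF s(4)] by auto
  moreover have "row_prod (hd s) = row_prod xs"
    using row_prod_step[OF s(3,2)] is_rep_SL2[OF s(4), of "hd s"] calculation by simp
  ultimately show ?case using Cons.IH[OF s(4)] s(1) by simp
qed

section \<open>Simultaneous conjugation by an invertible matrix\<close>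

definition cj :: "cmat \<Rightarrow> cmat \<Rightarrow> cmat" where
  "cj g x = g ** x ** minv g"

context
  fixes g :: cmat
  assumes g: "det g \<noteq> 0"
begin

lemma cj_mult: "cj g (x ** y) = cj g x ** cj g y"
proof -
  have "cj g x ** cj g y = g ** x ** (minv g ** g) ** y ** minv g"
    by (simp only: cj_def matrix_mul_assoc)
  then show ?thesis by (simp add: minv_mult[OF g] cj_def matrix_mul_assoc)
qed

lemma cj_SL2: "x \<in> SL2 \<Longrightarrow> cj g x \<in> SL2"
proof -
  assume x: "x \<in> SL2"
  have "det g * det (minv g) = det (g ** minv g)" by (simp add: det_mul)
  also have "\<dots> = 1" by (simp add: minv_mult[OF g])
  finally show ?thesis using x by (simp add: SL2_def cj_def det_mul)
qed

lemma cj_minv: "x \<in> SL2 \<Longrightarrow> cj g (minv x) = minv (cj g x)"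
proof -
  assume x: "x \<in> SL2"
  have "cj g (mat 1) = mat 1" by (simp add: cj_def minv_mult[OF g])
  then show ?thesis
    by (intro minv_unique[symmetric]) (simp_all add: cj_mult[symmetric] SL2_cancel[OF x])
qed

lemma trace_cj: "trace (cj g x) = trace x"
  unfolding cj_def trace_mul_sym[of "g ** x"] by (simp add: matrix_mul_assoc minv_mult[OF g])

lemma bform_cj:
  assumes "x \<in> SL2" shows "bform (cj g x) (cj g y) = bform x y"
proof -
  have "bform (cj g x) (cj g y) = trace (minv (cj g x) ** cj g y)"
    using cj_SL2[OF assms] by (simp add: trace_minv_mult SL2_def)
  also have "\<dots> = trace (minv x ** y)" by (simp add: cj_minv[OF assms, symmetric] cj_mult[symmetric] trace_cj)
  finally show ?thesis using assms by (simp add: trace_minv_mult SL2_def)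
qed

lemma cj_eq: "x ** g = g ** a \<Longrightarrow> cj g a = x"
  by (metis cj_def matrix_mul_assoc matrix_mul_rid minv_mult(1)[OF g])

lemma step_conj:
  assumes "step h xs ys" "set xs \<subseteq> SL2" "set ys \<subseteq> SL2"
  shows "step h (map (cj g) xs) (map (cj g) ys)"
  using assms
proof (cases rule: step_cases)
  case (over_left i us a b vs)
  then show ?thesis using assms step_Cross(1)[of "map (cj g) us" i]
    by (simp add: cj_mult cj_minv)
next
  case (over_right i us a b vs)
  then show ?thesis using assms step_Cross(2)[of "map (cj g) us" i]
    by (simp add: cj_mult cj_minv conjm_def)
next
  case (birth i us y vs)
  then show ?thesis using assms step_Birth[of "map (cj g) us" i] by (auto simp: cj_minv)
next
  case (death i us a vs)
  then show ?thesis using assms step_Death[of "map (cj g) us" i] by (simp add: cj_minv)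
qed

lemma is_rep_conj: "is_rep w m sts \<Longrightarrow> is_rep w m (map (map (cj g)) sts)"
proof (induction w arbitrary: m sts)
  case Nil then show ?case using cj_SL2 by (auto simp: is_rep_Nil subset_iff)
next
  case (Cons h w)
  then obtain xs s where s: "sts = xs # s" "length xs = m" "set xs \<subseteq> SL2" "step h xs (hd s)"
    "is_rep w (length (hd s)) s" by (auto simp: is_rep_Cons)
  have ne: "s \<noteq> []" using is_rep_length[OF s(5)] by auto
  then have "set (hd s) \<subseteq> SL2" using is_rep_SL2[OF s(5)] by simp
  then have "step h (map (cj g) xs) (map (cj g) (hd s))" by (rule step_conj[OF s(4,3)])
  then show ?case using s Cons.IH[OF s(5)] ne cj_SL2 by (auto simp: is_rep_Cons hd_map subset_iff)
qed

end

section \<open>Tangles as relations between matrices, their gluing and closure\<close>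

abbreviation row2 :: "cmat \<Rightarrow> cmat list" where
  "row2 x \<equiv> [x, minv x]"

definition transports :: "gen list \<Rightarrow> cmat \<Rightarrow> cmat \<Rightarrow> bool" where
  "transports T x y \<longleftrightarrow> (\<exists>s. is_rep T 2 s \<and> hd s = row2 x \<and> last s = row2 y)"

lemma transports_SL2: "transports T x y \<Longrightarrow> x \<in> SL2 \<and> y \<in> SL2"
proof -
  assume "transports T x y"
  then obtain s where s: "is_rep T 2 s" "hd s = row2 x" "last s = row2 y" by (auto simp: transports_def)
  have "s \<noteq> []" using is_rep_length[OF s(1)] by auto
  then have "set (hd s) \<subseteq> SL2" "set (last s) \<subseteq> SL2" by (simp_all add: is_rep_SL2[OF s(1)])
  then show ?thesis using s by simp
qed

lemma transports_conj:
  assumes "transports T x y" "det g \<noteq> 0" shows "transports T (cj g x) (cj g y)"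
proof -
  obtain s where s: "is_rep T 2 s" "hd s = row2 x" "last s = row2 y" using assms by (auto simp: transports_def)
  have "s \<noteq> []" using is_rep_length[OF s(1)] by auto
  then show ?thesis unfolding transports_def
    using is_rep_conj[OF assms(2) s(1)] s(2,3) transports_SL2[OF assms(1)]
    by (intro exI[of _ "map (map (cj g)) s"]) (auto simp: hd_map last_map cj_minv[OF assms(2)])
qed

text \<open>Trivial \<open>g_rho\<close> makes the top row a matrix and its inverse; invariance of
  the holonomy forces the same shape at the bottom.\<close>

lemma transports_of_Rt:
  assumes "s \<in> Rt t T" "g_rho s = mat 1" "tangle22 T"
  shows "transports T (hd s ! 0) (last s ! 0)" "hd s ! 0 \<in> Gt t" "last s ! 0 \<in> Gt t"
    "tr_v s = bform (hd s ! 0) (last s ! 0)"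
    "rho_ne s = hd s ! 0" "rho_se s = minv (last s ! 0)"
proof -
  have rep: "is_rep T 2 s" and G: "\<And>xs x. xs \<in> set s \<Longrightarrow> x \<in> set xs \<Longrightarrow> x \<in> Gt t"
    using assms by (auto simp: Rt_def)
  have ne: "s \<noteq> []" using is_rep_length[OF rep] by auto
  then have "length (hd s) = 2" using rep by (simp add: is_rep_def hd_conv_nth)
  then obtain a a' where h: "hd s = [a, a']" by (auto simp: length_Suc_conv numeral_2_eq_2)
  have "length (last s) = 2" using is_rep_length_last[OF rep] assms(3) by (simp add: tangle22_def)
  then obtain b b' where l: "last s = [b, b']" by (auto simp: length_Suc_conv numeral_2_eq_2)
  have GG: "a \<in> Gt t" "a' \<in> Gt t" "b \<in> Gt t" "b' \<in> Gt t"
    using G[OF hd_in_set[OF ne]] G[OF last_in_set[OF ne]] by (auto simp: h l)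
  then have S: "a \<in> SL2" "a' \<in> SL2" "b \<in> SL2" "b' \<in> SL2" by (auto simp: Gt_def)
  have e: "minv a ** minv a' = mat 1" using assms(2) by (simp add: g_rho_def rho_nw_def rho_ne_def h)
  have "a ** minv a ** minv a' = a" using e by (simp add: matrix_mul_assoc[symmetric])
  then have a': "minv a' = a" by (simp add: SL2_cancel[OF S(1)])
  then have a: "a' = minv a" using S(2) minv_minv[of a'] by (simp add: SL2_def)
  have "b' ** b = a' ** a" using row_prod_rep[OF rep] by (simp add: h l)
  also have "\<dots> = mat 1" by (simp add: a SL2_cancel[OF S(1)])
  finally have "b' ** b ** minv b = minv b" by simp
  then have b: "b' = minv b" by (simp add: SL2_cancel[OF S(3)])
  show "transports T (hd s ! 0) (last s ! 0)" unfolding transports_def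
    using rep h l a b by auto
  show "hd s ! 0 \<in> Gt t" "last s ! 0 \<in> Gt t" using GG h l by auto
  show "tr_v s = bform (hd s ! 0) (last s ! 0)"
    using S by (simp add: tr_v_def rho_sw_def rho_nw_def h l trace_mult_minv SL2_def)
  show "rho_ne s = hd s ! 0" "rho_se s = minv (last s ! 0)"
    by (simp_all add: rho_ne_def rho_se_def h l a' b)
qed

text \<open>The rows at the junctions are recorded because the vertices of the polygon are later
  read off there as values of generators.\<close>

lemma transports_concat:
  assumes "\<And>i. i < m \<Longrightarrow> transports (Ts ! i) (x i) (x (Suc i))" "m \<le> length Ts" "x 0 \<in> SL2"
  shows "\<exists>sts. is_rep (concat (take m Ts)) 2 sts \<and> hd sts = row2 (x 0) \<and>
    (\<forall>i\<le>m. sts ! length (concat (take i Ts)) = row2 (x i))"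
  using assms(1,2)
proof (induction m)
  case 0
  then show ?case using assms(3)
    by (intro exI[of _ "[row2 (x 0)]"]) (auto simp: is_rep_Nil SL2_def det_minv)
next
  case (Suc m)
  then obtain sts where sts: "is_rep (concat (take m Ts)) 2 sts" "hd sts = row2 (x 0)"
    "\<And>i. i \<le> m \<Longrightarrow> sts ! length (concat (take i Ts)) = row2 (x i)" by auto
  obtain s where s: "is_rep (Ts ! m) 2 s" "hd s = row2 (x m)" "last s = row2 (x (Suc m))"
    using Suc.prems by (auto simp: transports_def)
  have l: "length sts = length (concat (take m Ts)) + 1" "length s = length (Ts ! m) + 1"
    using is_rep_length sts(1) s(1) by blast+
  have ne: "sts \<noteq> []" "s \<noteq> []" using l by auto
  have tk: "concat (take (Suc m) Ts) = concat (take m Ts) @ Ts ! m"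
    using Suc.prems(2) by (simp add: take_Suc_conv_app_nth)
  have last: "last sts = row2 (x m)" using sts(3)[of m] l ne by (simp add: last_conv_nth)
  have rep: "is_rep (concat (take (Suc m) Ts)) 2 (sts @ tl s)"
    unfolding tk by (rule is_rep_append[OF sts(1) s(1)]) (simp add: last s)
  have "(sts @ tl s) ! length (concat (take i Ts)) = row2 (x i)" if "i \<le> Suc m" for i
  proof (cases "i = Suc m")
    case True
    have "sts @ tl s \<noteq> []" using ne by simp
    then have "(sts @ tl s) ! length (concat (take (Suc m) Ts)) = last (sts @ tl s)"
      using is_rep_length[OF rep] by (simp add: last_conv_nth)
    also have "\<dots> = row2 (x (Suc m))"
      using s last ne by (cases s) (auto simp: last_append)
    finally show ?thesis using True by simp
  next
    case False
    then have i: "i \<le> m" using that by simp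
    have "take m Ts = take i Ts @ drop i (take m Ts)" using i by (metis append_take_drop_id min.absorb1 take_take)
    then have "length (concat (take m Ts)) = length (concat (take i Ts)) + length (concat (drop i (take m Ts)))"
      by (metis concat_append length_append)
    then show ?thesis using sts(3)[OF i] l by (simp add: nth_append)
  qed
  then show ?case using rep sts(2) ne by (intro exI[of _ "sts @ tl s"]) auto
qed

lemma step_shift:
  assumes "step h xs ys" shows "step (shift_gen 1 h) (y # xs @ [z]) (y # ys @ [z])"
  using assms
proof (cases rule: step_cases)
  case (over_left i us a b vs)
  then show ?thesis using step_Cross(1)[of "y # us" "i + 1" a b "vs @ [z]"] by simp
next
  case (over_right i us a b vs)
  then show ?thesis using step_Cross(2)[of "y # us" "i + 1" a b "vs @ [z]"] by simp
next
  case (birth i us v vs)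
  then show ?thesis using step_Birth[of "y # us" "i + 1" "vs @ [z]"] by auto
next
  case (death i us a vs)
  then show ?thesis using step_Death[of "y # us" "i + 1" a _ "vs @ [z]"] by simp
qed

lemma is_rep_shift:
  assumes "is_rep w m sts" "y \<in> SL2" "z \<in> SL2"
  shows "is_rep (map (shift_gen 1) w) (m + 2) (map (\<lambda>r. y # r @ [z]) sts)"
  using assms(1)
proof (induction w arbitrary: m sts)
  case Nil then show ?case using assms by (auto simp: is_rep_Nil)
next
  case (Cons h w)
  then obtain xs s where s: "sts = xs # s" "length xs = m" "set xs \<subseteq> SL2" "step h xs (hd s)"
    "is_rep w (length (hd s)) s" by (auto simp: is_rep_Cons)
  have ne: "s \<noteq> []" using is_rep_length[OF s(5)] by auto
  have "step (shift_gen 1 h) (y # xs @ [z]) (y # hd s @ [z])" by (rule step_shift[OF s(4)])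
  then show ?case using s Cons.IH[OF s(5)] ne assms by (auto simp: is_rep_Cons hd_map)
qed

text \<open>The closing arcs add strands carrying \<open>minv z\<close> on the left and
  \<open>z\<close> on the right, matching the ends \<open>z\<close> and \<open>minv z\<close> of
  \<open>T\<close>. The two births and the two deaths account for the extra rows.\<close>

lemma is_rep_denom:
  assumes "is_rep T 2 sts" "hd sts = row2 z" "last sts = row2 z" "z \<in> SL2"
  shows "is_rep (denom T) 0
    ([] # [minv z, z] # map (\<lambda>r. minv z # r @ [z]) sts @ [[minv z, z], []])"
proof -
  have z: "minv z \<in> SL2" "minv (minv z) = z" using assms(4) by (auto simp: SL2_def det_minv minv_minv)
  have ne: "sts \<noteq> []" using is_rep_length[OF assms(1)] by auto
  let ?M = "map (\<lambda>r. minv z # r @ [z]) sts"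
  have M: "is_rep (map (shift_gen 1) T) 4 ?M" "last ?M = [minv z, z, minv z, z]"
    "hd ?M = [minv z, z, minv z, z]" "?M \<noteq> []"
    using is_rep_shift[OF assms(1) z(1) assms(4)] ne by (simp_all add: last_map hd_map assms(2,3))
  have "is_rep [Death 0, Death 0] 4 [[minv z, z, minv z, z], [minv z, z], []]"
    using z assms(4) by (simp add: is_rep_Cons is_rep_Nil step.simps)
  from is_rep_append[OF M(1) this] M(2)
  have "is_rep (map (shift_gen 1) T @ [Death 0, Death 0]) 4 (?M @ [[minv z, z], []])" by simp
  moreover have "hd (?M @ [[minv z, z], []]) = [minv z, z, minv z, z]" using M(3,4) by simp
  ultimately show ?thesis using z assms(4)
    unfolding denom_def append_Cons append_Nil
    by (simp add: is_rep_Cons step.simps exI[of _ "minv z"] eval_nat_numeral)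
qed

text \<open>Evaluated on representations, every polynomial in character values is a polynomial in
  the entries of finitely many generators and their inverses. All these functions lie in one
  Noetherian ring.\<close>

lemma zariski_noetherian_Xirr: "zariski_noetherian (Xirr K)"
proof -
  define R where "R = {sts. is_rep K 0 sts}"
  \<comment> \<open>Outside this finite box every representation takes the default value
    \<open>mat 1\<close>.\<close>
  define L where "L = {..length K} \<times> {..<2 * length K}"
  define G where "G = (\<lambda>(p, i, j) sts. val sts p $ i $ j) ` (L \<times> UNIV \<times> UNIV) \<union>
    (\<lambda>(p, i, j) sts. minv (val sts p) $ i $ j) ` (L \<times> UNIV \<times> UNIV)"
  have "finite G" by (simp add: G_def L_def)
  then obtain A where A: "noetherian_subring A" "range (\<lambda>c _. c) \<subseteq> A" "G \<subseteq> A"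
    using noetherian_function_algebra by blast
  have ring: "subring1 A" using A(1) by (simp add: noetherian_subring_def)
  have const: "(\<lambda>_. c) \<in> A" for c using A(2) by auto
  have add: "(\<lambda>s. f s + h s) \<in> A" and mult: "(\<lambda>s. f s * h s) \<in> A" if "f \<in> A" "h \<in> A" for f h
    using subring1D(4,6)[OF ring that] by (simp_all add: plus_fun_def times_fun_def)
  \<comment> \<open>Agreement is asked only on actual representations, as only for them are the
    values outside \<open>L\<close> constant.\<close>
  define rep where "rep f \<longleftrightarrow> (\<exists>h\<in>A. \<forall>sts\<in>R. f sts = h sts)" for f :: "cmat list list \<Rightarrow> complex"
  have rep_const: "rep (\<lambda>_. c)" for c using const by (auto simp: rep_def)
  have rep_add: "rep (\<lambda>s. f s + h s)" if "rep f" "rep h" for f h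
    using that add unfolding rep_def by fastforce
  have rep_mult: "rep (\<lambda>s. f s * h s)" if "rep f" "rep h" for f h
    using that mult unfolding rep_def by fastforce
  have out: "val sts p = mat 1" if "p \<notin> L" "sts \<in> R" for sts p
    using that is_rep_length[of K 0 sts] is_rep_length_bound[of K 0 sts "sts ! fst p"]
    by (cases p) (fastforce simp: val_def L_def R_def)
  have inv1: "minv (mat 1) = mat 1" by (rule minv_unique) simp_all
  have gen: "rep (\<lambda>s. val s p $ i $ j)" "rep (\<lambda>s. minv (val s p) $ i $ j)" for p i j
  proof -
    have "rep (\<lambda>s. val s p $ i $ j) \<and> rep (\<lambda>s. minv (val s p) $ i $ j)"
    proof (cases "p \<in> L")
      case True
      then have "(\<lambda>s. val s p $ i $ j) \<in> G" "(\<lambda>s. minv (val s p) $ i $ j) \<in> G"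
        unfolding G_def by (auto intro!: rev_image_eqI[of "(p, i, j)"])
      then show ?thesis using A(3) by (auto simp: rep_def)
    next
      case False
      then show ?thesis using out[OF False] rep_const[of "mat 1 $ i $ j"] by (simp add: rep_def inv1)
    qed
    then show "rep (\<lambda>s. val s p $ i $ j)" "rep (\<lambda>s. minv (val s p) $ i $ j)" by auto
  qed
  have word: "rep (\<lambda>s. eval_word s u $ i $ j)" for u i j
  proof (induction u arbitrary: i j)
    case Nil then show ?case using rep_const by simp
  next
    case (Cons a u)
    obtain p b where a: "a = (p, b)" by (cases a)
    show ?case
      unfolding a eval_word.simps matrix_matrix_mult_def vec_lambda_beta sum_2
      by (intro rep_add rep_mult Cons.IH) (cases b; simp add: gen)+
  qed
  have poly: "rep (\<lambda>s. f (character s))" if "poly_fn f" for f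
    using that
  proof induction
    case (pf_coord u)
    show ?case unfolding character_def trace_def sum_2 by (intro rep_add word)
  qed (auto intro: rep_const rep_add rep_mult)
  show ?thesis unfolding zariski_noetherian_def
  proof (intro allI impI)
    fix f :: "nat \<Rightarrow> (gword \<Rightarrow> complex) \<Rightarrow> complex" assume f: "\<forall>n. poly_fn (f n)"
    have "\<forall>n. \<exists>h. h \<in> A \<and> (\<forall>sts\<in>R. f n (character sts) = h sts)"
      using poly f unfolding rep_def by blast
    then obtain h where h: "\<And>n. h n \<in> A" "\<And>n sts. sts \<in> R \<Longrightarrow> f n (character sts) = h n sts"
      by metis
    obtain n where n: "h n \<in> ideal_span A (h ` {..<n})"
      using A(1) h(1) unfolding noetherian_subring_def by blast
    have vanish: "y sts = 0" if "y \<in> ideal_span A (h ` {..<n})" "\<forall>i<n. h i sts = 0" for y sts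
      using that(1) by induction (use that(2) in auto)
    show "\<exists>n. \<forall>x\<in>Xirr K. (\<forall>i<n. f i x = 0) \<longrightarrow> f n x = 0"
    proof (intro exI ballI impI)
      fix x assume "x \<in> Xirr K" and z: "\<forall>i<n. f i x = 0"
      then obtain sts where "x = character sts" "sts \<in> R" by (auto simp: Xirr_def R_def)
      then show "f n x = 0" using z h(2) vanish[OF n, of sts] by simp
    qed
  qed
qed

section \<open>Closed polygons of matrices\<close>

text \<open>The generic pair at vertices 1 and 2 makes the glued representation irreducible.\<close>

definition polygons :: "nat \<Rightarrow> gen list list \<Rightarrow> complex \<Rightarrow> (nat \<Rightarrow> cmat) set" where
  "polygons n Ts t = {x. (\<forall>i\<le>n. x i \<in> slt t \<and> transports (Ts ! i) (x i) (x (Suc i))) \<and>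
     x (Suc n) = x 0 \<and> generic_pair t (x 1) (x 2)}"

text \<open>Index 0 stands for the trace, so that \<open>t\<close> and the diagonals form a single
  family of functions to fibre over.\<close>

definition diagonal :: "nat \<Rightarrow> (nat \<Rightarrow> cmat) \<Rightarrow> complex" where
  "diagonal j x = (if j = 0 then trace (x 0) else bform (x 0) (x j))"

lemma infinite_complement: "finite (A :: complex set) \<Longrightarrow> infinite (- A)"
  using finite_Un[of A "- A"] infinite_UNIV_char_0[where 'a = complex] by (simp add: Compl_partition)

text \<open>Generic pairs with equal \<open>t\<close> and equal side length are conjugate, so a
  tangle that joins one such pair joins all of them. This is the source of
  \<open>glue\<close>.\<close>

context
  fixes n :: nat and Ts :: "gen list list" and t :: complex and s :: "nat \<Rightarrow> complex"
  assumes glue: "\<And>i p q. 1 \<le> i \<Longrightarrow> i \<le> n \<Longrightarrow> generic_pair t p q \<Longrightarrow> bform p q = s i \<Longrightarrow>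
      transports (Ts ! i) p q"
    and s: "\<And>i. 1 \<le> i \<Longrightarrow> i \<le> n \<Longrightarrow> s i \<notin> {2, t\<^sup>2 - 2}"
begin

text \<open>A generic diagonal can be given any length, so the polygon is completed one triangle at a
  time, fanning out from the vertex \<open>x 0\<close>.\<close>

lemma thick_polygons_from:
  assumes "k \<le> n - 1" "2 \<le> k" "2 < n" "\<And>i. i \<le> k \<Longrightarrow> x i \<in> slt t"
    "\<And>i. i < k \<Longrightarrow> transports (Ts ! i) (x i) (x (Suc i))"
    "generic_pair t (x 0) (x k)" "generic_pair t (x 1) (x 2)"
  shows "thick diagonal [Suc k..<n] {y \<in> polygons n Ts t. \<forall>i\<le>k. y i = x i}"
  using assms(1,2,4-)
proof (induction k arbitrary: x rule: inc_induct)
  case base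
  \<comment> \<open>The last vertex must realise two prescribed sides: \<open>s (n - 1)\<close> and
    the closing side \<open>s n\<close>.\<close>
  obtain z where z: "z \<in> slt t" "bform (x 0) z = s n" "bform (x (n - 1)) z = s (n - 1)"
    using generic_pair_extend[OF base(4)] by metis
  let ?y = "x(n := z, Suc n := x 0)"
  have tr1: "transports (Ts ! (n - 1)) (x (n - 1)) z"
    by (rule glue) (use z base s[of "n - 1"] \<open>2 < n\<close> in \<open>auto simp: generic_pair_def\<close>)
  have tr2: "transports (Ts ! n) z (x 0)"
    by (rule glue) (use z base s[of n] \<open>2 < n\<close> in \<open>auto simp: generic_pair_def bform_sym[of z]\<close>)
  have "?y i \<in> slt t \<and> transports (Ts ! i) (?y i) (?y (Suc i))" if i: "i \<le> n" for i
  proof -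
    consider "i < n - 1" | "i = n - 1" | "i = n" using i by linarith
    then show ?thesis
    proof cases
      case 1
      then have "?y i = x i" "?y (Suc i) = x (Suc i)" by auto
      then show ?thesis using base(2)[of i] base(3)[of i] 1 by simp
    next
      case 2
      then have "?y i = x (n - 1)" "?y (Suc i) = z" using \<open>2 < n\<close> by auto
      then show ?thesis using tr1 base(2)[of "n - 1"] 2 by simp
    next
      case 3 then show ?thesis using tr2 z by simp
    qed
  qed
  moreover have "generic_pair t (?y 1) (?y 2)" "?y 0 = x 0" using base(5) \<open>2 < n\<close> by auto
  ultimately have "?y \<in> polygons n Ts t" by (simp add: polygons_def)
  then have "?y \<in> {y \<in> polygons n Ts t. \<forall>i\<le>n - 1. y i = x i}" using \<open>2 < n\<close> by auto
  then show ?case using \<open>2 < n\<close> by (auto simp del: fun_upd_apply)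
next
  case (step k)
  have kn: "Suc k < n" using step(2) by simp
  have "thick diagonal [Suc (Suc k)..<n]
      ({y \<in> polygons n Ts t. \<forall>i\<le>k. y i = x i} \<inter> {y. diagonal (Suc k) y = u})"
    if u: "u \<notin> {2, t\<^sup>2 - 2}" for u
  proof -
    obtain z where z: "z \<in> slt t" "bform (x 0) z = u" "bform (x k) z = s k"
      using generic_pair_extend[OF step.prems(4)] by metis
    let ?x = "x(Suc k := z)"
    have "transports (Ts ! k) (x k) z"
      by (rule glue) (use z kn step.prems s[of k] in \<open>auto simp: generic_pair_def\<close>)
    then have "transports (Ts ! i) (?x i) (?x (Suc i))" if "i < Suc k" for i
      using step.prems(3)[of i] that by (auto simp: less_Suc_eq)
    moreover have "?x i \<in> slt t" if "i \<le> Suc k" for i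
      using step.prems(2)[of i] that z by (auto simp: le_Suc_eq)
    \<comment> \<open>Avoiding two values of \<open>u\<close> keeps the new diagonal generic, so the
      next triangle can be erected on it.\<close>
    moreover have "generic_pair t (?x 0) (?x (Suc k))"
      using u z step.prems(2)[of 0] by (simp add: generic_pair_def)
    moreover have "generic_pair t (?x 1) (?x 2)" using step.prems(1,5) by auto
    ultimately have "thick diagonal [Suc (Suc k)..<n] {y \<in> polygons n Ts t. \<forall>i\<le>Suc k. y i = ?x i}"
      using step.IH[of ?x] step.prems(1) by simp
    then show ?thesis
    proof (rule thick_mono)
      show "{y \<in> polygons n Ts t. \<forall>i\<le>Suc k. y i = ?x i}
        \<subseteq> {y \<in> polygons n Ts t. \<forall>i\<le>k. y i = x i} \<inter> {y. diagonal (Suc k) y = u}"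
        using z(2) by (auto simp: diagonal_def le_Suc_eq)
    qed
  qed
  then have "- {2, t\<^sup>2 - 2} \<subseteq> {u. thick diagonal [Suc (Suc k)..<n]
      ({y \<in> polygons n Ts t. \<forall>i\<le>k. y i = x i} \<inter> {y. diagonal (Suc k) y = u})}" by auto
  moreover have "infinite (- {2, t\<^sup>2 - 2})" by (rule infinite_complement) simp
  ultimately have "infinite {u. thick diagonal [Suc (Suc k)..<n]
      ({y \<in> polygons n Ts t. \<forall>i\<le>k. y i = x i} \<inter> {y. diagonal (Suc k) y = u})}" by (rule infinite_super)
  then show ?case using kn by (simp add: upt_conv_Cons)
qed

text \<open>The side from \<open>a\<close> to \<open>b\<close> may be degenerate; the fan starts at
  the diagonal from \<open>a\<close> to \<open>c\<close>. Fixing \<open>y 0\<close> and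
  \<open>y 2\<close> fixes the value of \<open>diagonal 2\<close>.\<close>

lemma thick_polygons_from_triangle:
  assumes "3 \<le> n" "transports (Ts ! 0) a b" "transports (Ts ! 1) b c" "generic_pair t a c" "generic_pair t b c"
  shows "thick diagonal [3..<n] {y \<in> polygons n Ts t. y 0 = a \<and> y 2 = c}"
proof -
  define x where "x i = (if i = 0 then a else if i = 1 then b else c)" for i :: nat
  have x: "x 0 = a" "x 1 = b" "x 2 = c" by (simp_all add: x_def)
  have "thick diagonal [Suc 2..<n] {y \<in> polygons n Ts t. \<forall>i\<le>2. y i = x i}"
  proof (rule thick_polygons_from)
    show "x i \<in> slt t" for i using assms(4,5) by (auto simp: x_def generic_pair_def)
    show "transports (Ts ! i) (x i) (x (Suc i))" if "i < 2" for i
      using assms(2,3) less_2_cases[OF that] x by (auto simp: numeral_2_eq_2)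
  qed (use assms x in auto)
  moreover have "Suc 2 = 3" by simp
  ultimately have "thick diagonal [3..<n] {y \<in> polygons n Ts t. \<forall>i\<le>2. y i = x i}" by (simp only:)
  then show ?thesis
  proof (rule thick_mono)
    have "y 0 = a \<and> y 2 = c" if "\<forall>i\<le>2. y i = x i" for y :: "nat \<Rightarrow> cmat"
      using that[rule_format, of 0] that[rule_format, of 2] x by simp
    then show "{y \<in> polygons n Ts t. \<forall>i\<le>2. y i = x i} \<subseteq> {y \<in> polygons n Ts t. y 0 = a \<and> y 2 = c}" by blast
  qed
qed

text \<open>The diagonal 2 is free here. Avoiding 2 and t^2 - 2 keeps it generic; avoiding
  \<open>s 1\<close> and t^2 - \<open>s 1\<close> makes \<open>noncommuting_pair_extend\<close>
  applicable.\<close>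

lemma thick_polygons_noncommuting:
  assumes "3 \<le> n" "t\<^sup>2 \<noteq> 4" "a \<in> slt t" "b \<in> slt t" "transports (Ts ! 0) a b" "a ** b \<noteq> b ** a"
  shows "thick diagonal [2..<n] (polygons n Ts t)"
proof -
  have "thick diagonal [3..<n] (polygons n Ts t \<inter> {y. diagonal 2 y = u})"
    if u: "u \<notin> {2, t\<^sup>2 - 2, s 1, t\<^sup>2 - s 1}" for u
  proof -
    obtain z where z: "z \<in> slt t" "bform a z = u" "bform b z = s 1"
      using noncommuting_pair_extend[OF assms(3,4,6,2)] u by (metis insertCI)
    have bz: "generic_pair t b z" using assms z s[of 1] by (simp add: generic_pair_def)
    then have "transports (Ts ! 1) b z" using glue[of 1] z assms(1) by simp
    moreover have "generic_pair t a z" using assms(3) z u by (simp add: generic_pair_def)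
    ultimately have "thick diagonal [3..<n] {y \<in> polygons n Ts t. y 0 = a \<and> y 2 = z}"
      using thick_polygons_from_triangle assms(1,5) bz by blast
    then show ?thesis by (rule thick_mono) (use z in \<open>auto simp: diagonal_def\<close>)
  qed
  then have "- {2, t\<^sup>2 - 2, s 1, t\<^sup>2 - s 1} \<subseteq>
      {u. thick diagonal [3..<n] (polygons n Ts t \<inter> {y. diagonal 2 y = u})}" by auto
  moreover have "infinite (- {2, t\<^sup>2 - 2, s 1, t\<^sup>2 - s 1})" by (rule infinite_complement) simp
  moreover have "[2..<n] = 2 # [3..<n]" using assms(1) by (simp add: upt_conv_Cons)
  ultimately show ?thesis by (metis thick.simps(2) infinite_super)
qed

text \<open>As \<open>a\<close> is \<open>b\<close> or its inverse, the diagonal 2 takes one of the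
  values \<open>s 1\<close> and t^2 - \<open>s 1\<close>. It is no longer a parameter but still
  generic, so the free diagonals begin at 3.\<close>

lemma thick_polygons_commuting:
  assumes "3 \<le> n" "t\<^sup>2 \<noteq> 4" "a \<in> slt t" "b \<in> slt t" "transports (Ts ! 0) a b" "a ** b = b ** a"
    and c: "generic_pair t b c" "bform b c = s 1"
  shows "thick diagonal [3..<n] (polygons n Ts t)"
proof -
  have "a = b \<or> a = adj2 b" by (rule commuting_pair[OF assms(4,3) _ assms(2)]) (simp add: assms(6))
  then have "bform a c = bform b c \<or> bform a c = t\<^sup>2 - bform b c"
    using c(1) by (auto simp: bform_adj2 generic_pair_def slt_def power2_eq_square)
  moreover have "t\<^sup>2 - bform b c \<notin> {2, t\<^sup>2 - 2}"
    using c(1) by (auto simp: generic_pair_def diff_eq_eq add.commute[of _ 2] eq_diff_eq)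
  ultimately have ac: "generic_pair t a c" using c(1) assms(3) by (auto simp: generic_pair_def)
  have "transports (Ts ! 1) b c" using glue[of 1] c assms(1) by simp
  then have "thick diagonal [3..<n] {y \<in> polygons n Ts t. y 0 = a \<and> y 2 = c}"
    using thick_polygons_from_triangle assms(1,5) ac c(1) by blast
  then show ?thesis by (rule thick_mono) auto
qed

end

text \<open>\<open>denom\<close> puts two birth slices above the tangles and one strand to their
  left, hence the offset 2 and the position 1.\<close>

definition vertex_word :: "gen list list \<Rightarrow> nat \<Rightarrow> bool \<Rightarrow> gword" where
  "vertex_word Ts i b = [((2 + length (concat (take i Ts)), 1), b)]"

definition diagonal_character :: "gen list list \<Rightarrow> nat \<Rightarrow> (gword \<Rightarrow> complex) \<Rightarrow> complex" where
  "diagonal_character Ts j \<eta> = (if j = 0 then \<eta> (vertex_word Ts 0 True)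
     else \<eta> (vertex_word Ts 0 False @ vertex_word Ts j True))"

text \<open>Representations of the tangles are concatenated along the polygon, which closes up. The
  diagonals become traces of words, and the values at vertices 1 and 2 have no common
  eigenvector.\<close>

lemma polygon_character:
  assumes x: "x \<in> polygons n Ts t" and n: "1 < n" "length Ts = n + 1"
  shows "\<exists>\<eta> \<in> Xirr (denom (concat Ts)). \<forall>j\<le>n. diagonal_character Ts j \<eta> = diagonal j x"
proof -
  have tr: "\<And>i. i \<le> n \<Longrightarrow> transports (Ts ! i) (x i) (x (Suc i))" and cl: "x (Suc n) = x 0"
    and det: "\<And>i. i \<le> n \<Longrightarrow> det (x i) = 1" and gen: "generic_pair t (x 1) (x 2)"
    using x by (auto simp: polygons_def slt_def)
  have S: "x 0 \<in> SL2" using det[of 0] by (simp add: SL2_def)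
  obtain sts where sts: "is_rep (concat Ts) 2 sts" "hd sts = row2 (x 0)"
    "\<And>i. i \<le> Suc n \<Longrightarrow> sts ! length (concat (take i Ts)) = row2 (x i)"
    using transports_concat[of "Suc n" Ts x] tr n S by auto
  have len: "length sts = length (concat Ts) + 1" by (rule is_rep_length[OF sts(1)])
  then have "last sts = sts ! length (concat (take (Suc n) Ts))"
    using n by (subst last_conv_nth) auto
  then have last: "last sts = row2 (x 0)" using sts(3)[of "Suc n"] cl by simp
  define K where "K = [] # [minv (x 0), x 0] # map (\<lambda>r. minv (x 0) # r @ [x 0]) sts @ [[minv (x 0), x 0], []]"
  have K: "is_rep (denom (concat Ts)) 0 K" unfolding K_def by (rule is_rep_denom[OF sts(1,2) last S])
  have val: "val K (2 + length (concat (take i Ts)), 1) = x i" if "i \<le> n" for i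
  proof -
    have "concat Ts = concat (take i Ts) @ concat (drop i Ts)" by (metis append_take_drop_id concat_append)
    then have l: "length (concat (take i Ts)) < length sts" using len by simp
    then have "K ! (2 + length (concat (take i Ts))) = minv (x 0) # row2 (x i) @ [x 0]"
      using sts(3)[of i] that by (simp add: K_def nth_append)
    moreover have "2 + length (concat (take i Ts)) < length K" using l by (simp add: K_def)
    ultimately show ?thesis by (simp add: val_def)
  qed
  have ev: "eval_word K (vertex_word Ts i True @ u) = x i ** eval_word K u"
    "eval_word K (vertex_word Ts i False @ u) = minv (x i) ** eval_word K u" if "i \<le> n" for i u
    using val[OF that] by (simp_all add: vertex_word_def)
  have ev1: "eval_word K (vertex_word Ts i True) = x i" if "i \<le> n" for i
    using ev(1)[OF that, of "[]"] by simp
  have "irreducible_rep K"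
    unfolding irreducible_rep_def
  proof
    assume "\<exists>v. v \<noteq> 0 \<and> (\<forall>u. \<exists>c. eval_word K u *v v = c *s v)"
    then obtain v where v: "v \<noteq> 0" "\<And>u. \<exists>c. eval_word K u *v v = c *s v" by auto
    obtain c d where "x 1 *v v = c *s v" "x 2 *v v = d *s v"
      using v(2)[of "vertex_word Ts 1 True"] v(2)[of "vertex_word Ts 2 True"] ev1 n by auto
    then show False using generic_pair_no_common_eigenvector[OF gen v(1)] by blast
  qed
  then have "character K \<in> Xirr (denom (concat Ts))" using K by (auto simp: Xirr_def)
  moreover have "diagonal_character Ts j (character K) = diagonal j x" if "j \<le> n" for j
    using that det[of 0]
    by (simp add: diagonal_character_def diagonal_def character_def ev ev1 trace_minv_mult)
  ultimately show ?thesis by blast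
qed

lemma poly_fn_diagonal_character: "poly_fn (diagonal_character Ts j)"
  unfolding diagonal_character_def by (cases "j = 0") (simp_all add: pf_coord)

text \<open>The trace is the outermost parameter: polygons for different \<open>t\<close> lie in
  different fibres, and infinitely many \<open>t\<close> remain. This adds one to the number of
  diagonals.\<close>

lemma dim_ge_of_polygons:
  assumes "finite F" "1 < n" "length Ts = n + 1" "\<And>t. t \<notin> F \<Longrightarrow> thick diagonal js (polygons n Ts t)"
    "set js \<subseteq> {..n}"
  shows "dim_ge (Xirr (denom (concat Ts))) (Suc (length js))"
proof -
  let ?Y = "\<Union>t\<in>- F. polygons n Ts t"
  have "- F \<subseteq> {u. thick diagonal js (?Y \<inter> {y. diagonal 0 y = u})}"
  proof
    fix t assume t: "t \<in> - F"
    have "polygons n Ts t \<subseteq> ?Y \<inter> {y. diagonal 0 y = t}"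
      using t by (auto simp: polygons_def diagonal_def slt_def)
    then show "t \<in> {u. thick diagonal js (?Y \<inter> {y. diagonal 0 y = u})}"
      using thick_mono assms(4) t by blast
  qed
  then have "thick diagonal (0 # js) ?Y"
    using infinite_complement[OF assms(1)] infinite_super by auto
  then have "thick (diagonal_character Ts) (0 # js) (Xirr (denom (concat Ts)))"
  proof (rule thick_map)
    fix y assume "y \<in> ?Y"
    then obtain t where "y \<in> polygons n Ts t" by auto
    from polygon_character[OF this assms(2,3)]
    show "\<exists>x\<in>Xirr (denom (concat Ts)). \<forall>j\<in>set (0 # js). diagonal_character Ts j x = diagonal j y"
      using assms(5) by auto
  qed
  from dim_ge_of_thick[OF zariski_noetherian_Xirr poly_fn_diagonal_character this]
  show ?thesis by simp
qed

theorem theorem3p2: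
  fixes n :: nat and Ts :: "gen list list" and F :: "complex set"
    and \<rho> :: "complex \<Rightarrow> nat \<Rightarrow> cmat list list"
  assumes "n \<ge> 3"
    and "length Ts = n + 1"
    and "\<forall>i \<le> n. tangle22 (Ts ! i)"
    and "is_knot (denom (vcomp_all Ts))"
    and "finite F"
    and "\<forall>t. t \<notin> F \<longrightarrow>
           (\<forall>i \<le> n. \<rho> t i \<in> Rt t (Ts ! i) \<and> g_rho (\<rho> t i) = mat 1) \<and>
           (\<forall>i. 1 \<le> i \<and> i \<le> n \<longrightarrow> tr_v (\<rho> t i) \<notin> {2, t\<^sup>2 - 2})"
  shows "((\<forall>t. t \<notin> F \<longrightarrow>
            rho_ne (\<rho> t 0) ** rho_se (\<rho> t 0) \<noteq> rho_se (\<rho> t 0) ** rho_ne (\<rho> t 0))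
           \<longrightarrow> dim_ge (Xirr (denom (vcomp_all Ts))) (n - 1))
       \<and> ((\<forall>t. t \<notin> F \<longrightarrow>
            rho_ne (\<rho> t 0) ** rho_se (\<rho> t 0) = rho_se (\<rho> t 0) ** rho_ne (\<rho> t 0))
           \<longrightarrow> dim_ge (Xirr (denom (vcomp_all Ts))) (n - 2))"
proof -
  have cat: "vcomp_all Ts = concat Ts"
    by (induction Ts) (simp_all add: vcomp_all_def vcomp_def)
  \<comment> \<open>Removing 2 and -2 as well gives t^2 \<noteq> 4, on which
    \<open>noncommuting_pair_extend\<close> and \<open>commuting_pair\<close> rest.\<close>
  define F' where "F' = F \<union> {2, -2}"
  have fin: "finite F'" using assms(5) by (simp add: F'_def)
  have t4: "t\<^sup>2 \<noteq> 4" if "t \<notin> F'" for t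
    using that power2_eq_iff[of t 2] by (auto simp: F'_def)
  define a where "a t i = hd (\<rho> t i) ! 0" for t i
  define b where "b t i = last (\<rho> t i) ! 0" for t i
  define s where "s t i = bform (a t i) (b t i)" for t i
  have ends: "transports (Ts ! i) (a t i) (b t i)" "a t i \<in> Gt t" "b t i \<in> Gt t"
    "tr_v (\<rho> t i) = s t i" "rho_ne (\<rho> t i) = a t i" "rho_se (\<rho> t i) = minv (b t i)"
    if "t \<notin> F'" "i \<le> n" for t i
    using transports_of_Rt[of "\<rho> t i" t "Ts ! i"] assms(3,6) that
    by (auto simp: F'_def a_def b_def s_def)
  have slt: "a t i \<in> slt t" "b t i \<in> slt t" if "t \<notin> F'" "i \<le> n" for t i
    using ends(2,3)[OF that] by (auto simp: Gt_def SL2_def slt_def)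
  have s: "s t i \<notin> {2, t\<^sup>2 - 2}" if "t \<notin> F'" "1 \<le> i" "i \<le> n" for t i
    using assms(6) ends(4)[OF that(1,3)] that by (auto simp: F'_def)
  have gen: "generic_pair t (a t i) (b t i)" if "t \<notin> F'" "1 \<le> i" "i \<le> n" for t i
    using slt s that by (simp add: generic_pair_def s_def)
  have glue: "transports (Ts ! i) p q"
    if t: "t \<notin> F'" "1 \<le> i" "i \<le> n" and pq: "generic_pair t p q" "bform p q = s t i" for t i p q
  proof -
    obtain g where g: "det g \<noteq> 0" "p ** g = g ** a t i" "q ** g = g ** b t i"
      using generic_pairs_conjugate[OF gen[OF t] pq(1)] pq(2) by (auto simp: s_def)
    then show ?thesis
      using transports_conj[OF ends(1)[OF t(1,3)] g(1)] cj_eq[OF g(1)] by metis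
  qed
  have comm: "rho_ne (\<rho> t 0) ** rho_se (\<rho> t 0) = rho_se (\<rho> t 0) ** rho_ne (\<rho> t 0) \<longleftrightarrow>
      a t 0 ** b t 0 = b t 0 ** a t 0" if t: "t \<notin> F'" for t
  proof -
    have B: "b t 0 \<in> SL2" using ends(3)[OF t] by (auto simp: Gt_def)
    have "a t 0 ** b t 0 = b t 0 ** a t 0" if "a t 0 ** minv (b t 0) = minv (b t 0) ** a t 0"
      using arg_cong[OF that, of "\<lambda>x. b t 0 ** x ** b t 0"]
      by (simp add: matrix_mul_assoc SL2_cancel[OF B])
    moreover have "a t 0 ** minv (b t 0) = minv (b t 0) ** a t 0" if "a t 0 ** b t 0 = b t 0 ** a t 0"
      using arg_cong[OF that, of "\<lambda>x. minv (b t 0) ** x ** minv (b t 0)"]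
      by (simp add: matrix_mul_assoc SL2_cancel[OF B])
    ultimately show ?thesis using ends(5,6)[OF t, of 0] by auto
  qed
  show ?thesis unfolding cat
  proof (intro conjI impI)
    assume nc: "\<forall>t. t \<notin> F \<longrightarrow>
      rho_ne (\<rho> t 0) ** rho_se (\<rho> t 0) \<noteq> rho_se (\<rho> t 0) ** rho_ne (\<rho> t 0)"
    have "thick diagonal [2..<n] (polygons n Ts t)" if t: "t \<notin> F'" for t
    proof (rule thick_polygons_noncommuting[where s = "s t" and a = "a t 0" and b = "b t 0"])
      show "a t 0 ** b t 0 \<noteq> b t 0 ** a t 0" using nc comm[OF t] t by (auto simp: F'_def)
    qed (use glue[OF t] s[OF t] assms(1) t4[OF t] slt[OF t] ends(1)[OF t] in auto)
    from dim_ge_of_polygons[OF fin _ assms(2) this] assms(1)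
    show "dim_ge (Xirr (denom (concat Ts))) (n - 1)"
      by (auto simp: Suc_diff_Suc numeral_2_eq_2 subset_iff)
  next
    assume c: "\<forall>t. t \<notin> F \<longrightarrow>
      rho_ne (\<rho> t 0) ** rho_se (\<rho> t 0) = rho_se (\<rho> t 0) ** rho_ne (\<rho> t 0)"
    have "thick diagonal [3..<n] (polygons n Ts t)" if t: "t \<notin> F'" for t
    proof -
      \<comment> \<open>The pair of the second tangle is moved so that it starts where the first
        tangle ends. Both matrices lie in \<open>Gt t\<close>, so equal traces suffice for
        conjugacy.\<close>
      obtain g where g: "det g \<noteq> 0" "b t 0 ** g = g ** a t 1"
        using conjugate_of_trace_eq[OF ends(2)[OF t, of 1] ends(3)[OF t, of 0]] assms(1) by auto
      have tr: "transports (Ts ! 1) (b t 0) (cj g (b t 1))"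
        using transports_conj[OF ends(1)[OF t, of 1] g(1)] cj_eq[OF g] assms(1) by simp
      have e: "bform (b t 0) (cj g (b t 1)) = s t 1" "trace (cj g (b t 1)) = t"
        using bform_cj[OF g(1), of "a t 1" "b t 1"] cj_eq[OF g] ends(2,3)[OF t, of 1] assms(1)
        by (auto simp: s_def trace_cj[OF g(1)] Gt_def)
      have "generic_pair t (b t 0) (cj g (b t 1))"
        using s[OF t, of 1] assms(1) e slt(2)[OF t, of 0] transports_SL2[OF tr]
        by (auto simp: generic_pair_def slt_def SL2_def)
      then show ?thesis
        using thick_polygons_commuting[where n = n and Ts = Ts and t = t and s = "s t"
            and a = "a t 0" and b = "b t 0" and c = "cj g (b t 1)"] c comm[OF t] t
          glue[OF t] s[OF t] assms(1) t4[OF t] slt[OF t] ends(1)[OF t] e(1)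
        by (auto simp: F'_def)
    qed
    from dim_ge_of_polygons[OF fin _ assms(2) this] assms(1)
    show "dim_ge (Xirr (denom (concat Ts))) (n - 2)"
      by (auto simp: Suc_diff_Suc numeral_2_eq_2 numeral_3_eq_3 subset_iff)
  qed
qed

end
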